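(* Let $(X,\mathcal A)$ be as in case (i) or case (ii) of the context. Every superalgebraic set in $X$ is uniquely a finite union of irreducible superalgebraic components: for every superalgebraic set $V\subseteq X$ there are $r\ge 1$ and irreducible superalgebraic sets $V_1,\dots,V_r$ with $V=V_1\cup\dots\cup V_r$ and $V_i\not\subseteq V_j$ for $i\ne j$, and the collection $\{V_1,\dots,V_r\}$ is uniquely determined by $V$.
   Context: For $I\subseteq\mathcal A$ let $\mathcal V(I)=\{x\in X\mid f(x)=0\text{ for all }f\in I\}$; a superalgebraic set in $X$ is a set of this form. A superalgebraic set is irreducible if it cannot be written as the union of two proper superalgebraic subsets. $\Bbbk$ is an algebraically closed field of characteristic zero. One of the following two cases is assumed. Case (i). $\mathfrak g$ is one of the Kac-Moody (KM) superalgebras $\mathfrak{gl}(m|n)$, $\mathfrak{sl}(m|n)$ ($m\ne n$), $\mathfrak{osp}(r|2n)$, $D(2|1;\alpha)$, $F(4)$, $G(3)$, or $\mathfrak g=\mathfrak q(n)$. $\mathfrak h$ is a Cartan subalgebra of $\mathfrak g_0$, $W$ the Weyl group of $\mathfrak g_0$, $X=\mathfrak h^*$, $\mathcal O(X)=S(\mathfrak h)$ and $\mathcal A=I(\mathfrak h)$. In the KM case let $(\;,\;)$ be the non-degenerate $W$-invariant symmetric bilinear form on $\mathfrak h^*$ induced by the invariant form on $\mathfrak g$, $\Delta_{iso}$ the set of isotropic roots, $\Pi_\alpha=\{\lambda\in\mathfrak h^*\mid(\lambda,\alpha)=0\}$, and $$I(\mathfrak h)=\{f\in S(\mathfrak h)^W\mid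 f(\lambda)=f(\lambda+t\alpha)\text{ for all }\alpha\in\Delta_{iso},\ \lambda\in\Pi_\alpha,\ t\in\Bbbk\}.$$ For $\mathfrak q(n)$, $\mathfrak h^*=\Bbbk^n$ with coordinate functions $x_1,\dots,x_n$, $W=S_n$, and $I(\mathfrak h)=\{f\in\Bbbk[x_1,\dots,x_n]^{S_n}\mid f|_{x_n=-x_{n-1}=t}\text{ is independent of }t\}$. Case (ii). $G$ is one of the Lie supergroups $GL(m|n)$, $OSP(r|2n)$, $SL(m|n)$ ($m\neq n$), $P(n)$, $Q(n)$, with even part $G_0=GL(m)\times GL(n)$; $SO(r)\times SP(2n)$; $\{(A,B)\in GL(m)\times GL(n)\mid\det A=\det B\}$; $GL(n)$; $GL(n)$ respectively. $\mathbb T$ is a maximal torus of $G_0$, $W$ the Weyl group of $G_0$, $X(\mathbb T)$ the character group (the character attached to a weight $\mu$ is written $\mathtt e^\mu$), $X=\mathbb T$, $\mathcal O(X)=\Bbbk\otimes_{\mathbb Z}\mathbb Z[X(\mathbb T)]$ and $\mathcal A=J(G)\otimes_{\mathbb Z}\Bbbk\subseteq\mathcal O(X)^W$. Here $J(G)$ is the ring of supercharacters (of characters if $G=Q(n)$) of finite dimensional $\mathbb Z_2$-graded $G$-modules, i.e. the Grothendieck ring modulo the ideal generated by all $[\Pi M]+[M]$ (resp. $[\Pi M]-[M]$ for $Q(n)$), $\Pi$ being parity change, identified with its image in $\mathbb Z[X(\mathbb T)]^W$. Known explicit descriptions: for $GL,OSP,SL$, $J(G)=\{f\in\mathbb Z[X(\mathbb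 T)]^W\mid D_\alpha f\in(\mathtt e^\alpha-1)\ \forall\alpha\in\Delta_{iso}\}$ where $D_\alpha$ is the derivation $D_\alpha(\mathtt e^\mu)=(\alpha,\mu)\mathtt e^\mu$; for $P(n)$ (with $x_i=\mathtt e^{\epsilon_i}$ the coordinates of $\mathbb T\subset GL(n)$) $J(G)=\{f\in\mathbb Z[X(\mathbb T)]^{S_n}\mid f|_{x_n=x_{n-1}^{-1}=t}\text{ independent of }t\}$; for $Q(n)$, $J(G)\otimes\mathbb Z[\tfrac12]=\{f\in\mathbb Z[\tfrac12][X(\mathbb T)]^{S_n}\mid f|_{x_n=-x_{n-1}=t}\text{ independent of }t\}$. *)

theory Defs
  imports
    "HOL-Computational_Algebra.Polynomial"
    "Jordan_Normal_Form.Determinant"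
begin

section \<open>Superalgebraic sets\<close>

definition zero_locus :: "'x set \<Rightarrow> ('x \<Rightarrow> 'k::zero) set \<Rightarrow> 'x set" where
  "zero_locus X I = {x \<in> X. \<forall>f\<in>I. f x = 0}"

definition superalgebraic :: "'x set \<Rightarrow> ('x \<Rightarrow> 'k::zero) set \<Rightarrow> 'x set \<Rightarrow> bool" where
  "superalgebraic X \<A> V \<longleftrightarrow> (\<exists>I\<subseteq>\<A>. V = zero_locus X I)"

definition irreducible_superalgebraic ::
  "'x set \<Rightarrow> ('x \<Rightarrow> 'k::zero) set \<Rightarrow> 'x set \<Rightarrow> bool" where
  "irreducible_superalgebraic X \<A> V \<longleftrightarrow> superalgebraic X \<A> V \<and>
     \<not> (\<exists>V1 V2. superalgebraic X \<A> V1 \<and> superalgebraic X \<A> V2 \<and>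
            V1 \<subset> V \<and> V2 \<subset> V \<and> V = V1 \<union> V2)"

(* The empty set is irreducible in this sense, so that r \<ge> 1 is correct also for V = {}. *)
definition unique_irreducible_decompositions :: "'x set \<Rightarrow> ('x \<Rightarrow> 'k::zero) set \<Rightarrow> bool" where
  "unique_irreducible_decompositions X \<A> \<longleftrightarrow>
     (\<forall>V. superalgebraic X \<A> V \<longrightarrow>
        (\<exists>!\<C>. finite \<C> \<and> \<C> \<noteq> {} \<and> (\<forall>Z\<in>\<C>. irreducible_superalgebraic X \<A> Z) \<and>
              (\<forall>Y\<in>\<C>. \<forall>Z\<in>\<C>. Y \<noteq> Z \<longrightarrow> \<not> Y \<subseteq> Z) \<and> V = \<Union>\<C>))"

(* The k-algebra of functions generated by S. The field being infinite, polynomials are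
   identified with polynomial functions throughout. *)
inductive_set fun_algebra :: "('x \<Rightarrow> 'k::comm_ring_1) set \<Rightarrow> ('x \<Rightarrow> 'k) set"
  for S :: "('x \<Rightarrow> 'k) set" where
  gen: "f \<in> S \<Longrightarrow> f \<in> fun_algebra S"
| const: "(\<lambda>_. c) \<in> fun_algebra S"
| add: "f \<in> fun_algebra S \<Longrightarrow> g \<in> fun_algebra S \<Longrightarrow> (\<lambda>x. f x + g x) \<in> fun_algebra S"
| mult: "f \<in> fun_algebra S \<Longrightarrow> g \<in> fun_algebra S \<Longrightarrow> (\<lambda>x. f x * g x) \<in> fun_algebra S"

definition fun_span :: "('x \<Rightarrow> 'k::comm_ring_1) set \<Rightarrow> ('x \<Rightarrow> 'k) set" where
  "fun_span S = {(\<lambda>x. \<Sum>j<r. c j * F j x) | r c F. \<forall>j<(r::nat). F j \<in> S}"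


section \<open>Lie superalgebras\<close>

(* Parities are booleans: False is even, True is odd, and addition of parities is inequality. *)
definition ssign :: "bool \<Rightarrow> bool \<Rightarrow> 'k::ring_1" where
  "ssign a b = (if a \<and> b then - 1 else 1)"

locale lie_superalgebra = vector_space scale
  for scale :: "'k::field \<Rightarrow> 'g::ab_group_add \<Rightarrow> 'g" +
  fixes part :: "bool \<Rightarrow> 'g set" and br :: "'g \<Rightarrow> 'g \<Rightarrow> 'g"
  assumes finite_dim: "\<exists>B. finite B \<and> span B = UNIV"
    and part_subspace: "subspace (part a)"
    and part_disjoint: "part False \<inter> part True = {0}"
    and part_sum: "\<exists>u\<in>part False. \<exists>v\<in>part True. x = u + v"
    and br_add_left: "br (x + y) z = br x z + br y z"
    and br_add_right: "br x (y + z) = br x y + br x z"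
    and br_scale_left: "br (scale c x) y = scale c (br x y)"
    and br_scale_right: "br x (scale c y) = scale c (br x y)"
    and br_part: "x \<in> part a \<Longrightarrow> y \<in> part b \<Longrightarrow> br x y \<in> part (a \<noteq> b)"
    and br_skew: "x \<in> part a \<Longrightarrow> y \<in> part b \<Longrightarrow> br y x = scale (- ssign a b) (br x y)"
    and br_jacobi: "x \<in> part a \<Longrightarrow> y \<in> part b \<Longrightarrow>
          br x (br y z) = br (br x y) z + scale (ssign a b) (br y (br x z))"

subsection \<open>Matrix Lie superalgebras\<close>

definition mtrace :: "'k::comm_ring_1 mat \<Rightarrow> 'k" where
  "mtrace A = (\<Sum>i<dim_row A. A $$ (i,i))"

abbreviation even_block :: "nat \<Rightarrow> nat \<Rightarrow> 'k::zero mat \<Rightarrow> 'k mat \<Rightarrow> 'k mat" where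
  "even_block m n A D \<equiv> four_block_mat A (0\<^sub>m m n) (0\<^sub>m n m) D"

abbreviation odd_block :: "nat \<Rightarrow> nat \<Rightarrow> 'k::zero mat \<Rightarrow> 'k mat \<Rightarrow> 'k mat" where
  "odd_block m n B C \<equiv> four_block_mat (0\<^sub>m m m) B C (0\<^sub>m n n)"

definition mbr :: "bool \<Rightarrow> bool \<Rightarrow> 'k::comm_ring_1 mat \<Rightarrow> 'k mat \<Rightarrow> 'k mat" where
  "mbr a b x y = x * y - ssign a b \<cdot>\<^sub>m (y * x)"

definition gl_super :: "nat \<Rightarrow> nat \<Rightarrow> bool \<Rightarrow> 'k::comm_ring_1 mat set" where
  "gl_super m n a =
     (if a then {odd_block m n B C | B C. B \<in> carrier_mat m n \<and> C \<in> carrier_mat n m}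
      else {even_block m n A D | A D. A \<in> carrier_mat m m \<and> D \<in> carrier_mat n n})"

definition sl_super :: "nat \<Rightarrow> nat \<Rightarrow> bool \<Rightarrow> 'k::comm_ring_1 mat set" where
  "sl_super m n a =
     (if a then gl_super m n True
      else {even_block m n A D | A D. A \<in> carrier_mat m m \<and> D \<in> carrier_mat n n \<and>
              mtrace A = mtrace D})"

(* Gram matrices of split forms: with respect to these the diagonal matrices in SO(r) and SP(2n)
   form maximal tori. *)
definition sym_form :: "nat \<Rightarrow> 'k::comm_ring_1 mat" where
  "sym_form r = mat r r (\<lambda>(i,j). if i + j + 1 = r then 1 else 0)"

definition alt_form :: "nat \<Rightarrow> 'k::comm_ring_1 mat" where
  "alt_form n = mat (2*n) (2*n)
     (\<lambda>(i,j). if i + j + 1 = 2*n then (if i < n then 1 else - 1) else 0)"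

(* The condition is b(x u, v) + (-1)^(|x||u|) b(u, x v) = 0 on the standard basis vectors u, v,
   where b has Gram matrix J. *)
definition osp_super :: "nat \<Rightarrow> nat \<Rightarrow> bool \<Rightarrow> 'k::comm_ring_1 mat set" where
  "osp_super r n a =
     (let J = even_block r (2*n) (sym_form r) (alt_form n) in
      {x \<in> gl_super r (2*n) a. \<forall>i < r + 2*n. \<forall>j < r + 2*n.
         (transpose_mat x * J) $$ (i,j) + ssign a (r \<le> i) * (J * x) $$ (i,j) = 0})"

definition p_super :: "nat \<Rightarrow> bool \<Rightarrow> 'k::comm_ring_1 mat set" where
  "p_super n a =
     (if a then {odd_block n n B C | B C. B \<in> carrier_mat n n \<and> C \<in> carrier_mat n n \<and>
                   transpose_mat B = B \<and> transpose_mat C = - C}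
      else {even_block n n A (- transpose_mat A) | A. A \<in> carrier_mat n n})"

definition q_super :: "nat \<Rightarrow> bool \<Rightarrow> 'k::comm_ring_1 mat set" where
  "q_super n a =
     (if a then {odd_block n n B B | B. B \<in> carrier_mat n n}
      else {even_block n n A A | A. A \<in> carrier_mat n n})"

definition matrix_model ::
  "('k::field \<Rightarrow> 'g::ab_group_add \<Rightarrow> 'g) \<Rightarrow> (bool \<Rightarrow> 'g set) \<Rightarrow> ('g \<Rightarrow> 'g \<Rightarrow> 'g) \<Rightarrow>
   (bool \<Rightarrow> 'k mat set) \<Rightarrow> bool" where
  "matrix_model scale part br M \<longleftrightarrow>
     (\<exists>\<phi>. (\<forall>a. bij_betw \<phi> (part a) (M a)) \<and>
          (\<forall>a. \<forall>x\<in>part a. \<forall>y\<in>part a. \<phi> (x + y) = \<phi> x + \<phi> y) \<and>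
          (\<forall>a. \<forall>x\<in>part a. \<forall>c. \<phi> (scale c x) = c \<cdot>\<^sub>m \<phi> x) \<and>
          (\<forall>a b. \<forall>x\<in>part a. \<forall>y\<in>part b. \<phi> (br x y) = mbr a b (\<phi> x) (\<phi> y)))"

subsection \<open>Kac-Moody superalgebras of finite dimension\<close>

(* The contragredient Lie superalgebra of an invertible n x n Cartan matrix A with set \<tau> of odd
   simple roots: Chevalley generators e, f, h, and no nonzero ideal meeting the span of the
   h i trivially. *)
definition contragredient ::
  "('k::field \<Rightarrow> 'g::ab_group_add \<Rightarrow> 'g) \<Rightarrow> (bool \<Rightarrow> 'g set) \<Rightarrow> ('g \<Rightarrow> 'g \<Rightarrow> 'g) \<Rightarrow>
   'k mat \<Rightarrow> nat set \<Rightarrow> bool" where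
  "contragredient scale part br A \<tau> \<longleftrightarrow>
     (\<exists>e f h. let n = dim_row A; H = Modules.module.span scale (h ` {..<n}) in
        (\<forall>i<n. e i \<in> part (i \<in> \<tau>) \<and> f i \<in> part (i \<in> \<tau>) \<and> h i \<in> part False) \<and>
        (\<forall>i<n. \<forall>j<n. br (e i) (f j) = (if i = j then h i else 0) \<and>
            br (h i) (h j) = 0 \<and>
            br (h i) (e j) = scale (A $$ (i,j)) (e j) \<and>
            br (h i) (f j) = scale (- (A $$ (i,j))) (f j)) \<and>
        inj_on h {..<n} \<and> \<not> Modules.module.dependent scale (h ` {..<n}) \<and>
        (\<forall>S. Modules.module.subspace scale S \<and> (\<forall>x\<in>S. \<forall>y\<in>S. br x y \<in> S) \<and>
             (\<forall>i<n. e i \<in> S \<and> f i \<in> S \<and> h i \<in> S) \<longrightarrow> S = UNIV) \<and>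
        (\<forall>J. Modules.module.subspace scale J \<and> (\<forall>x. \<forall>y\<in>J. br x y \<in> J \<and> br y x \<in> J) \<and>
             J \<inter> H = {0} \<longrightarrow> J = {0}))"

(* Kac's distinguished Cartan matrices; the first simple root is odd, the others are even. *)
definition cartan_D21 :: "'k::field \<Rightarrow> 'k mat" where
  "cartan_D21 \<alpha> = mat_of_rows_list 3 [[0, 1, \<alpha>], [-1, 2, 0], [-1, 0, 2]]"

definition cartan_F4 :: "'k::field mat" where
  "cartan_F4 = mat_of_rows_list 4 [[0, 1, 0, 0], [-1, 2, -2, 0], [0, -1, 2, -1], [0, 0, -1, 2]]"

definition cartan_G3 :: "'k::field mat" where
  "cartan_G3 = mat_of_rows_list 3 [[0, 1, 0], [-1, 2, -3], [0, -1, 2]]"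

definition listed_KM_superalgebra ::
  "('k::field \<Rightarrow> 'g::ab_group_add \<Rightarrow> 'g) \<Rightarrow> (bool \<Rightarrow> 'g set) \<Rightarrow> ('g \<Rightarrow> 'g \<Rightarrow> 'g) \<Rightarrow> bool" where
  "listed_KM_superalgebra scale part br \<longleftrightarrow> lie_superalgebra scale part br \<and>
     ((\<exists>m n. matrix_model scale part br (gl_super m n)) \<or>
      (\<exists>m n. m \<noteq> n \<and> matrix_model scale part br (sl_super m n)) \<or>
      (\<exists>r n. matrix_model scale part br (osp_super r n)) \<or>
      (\<exists>\<alpha>. \<alpha> \<noteq> 0 \<and> \<alpha> \<noteq> - 1 \<and> contragredient scale part br (cartan_D21 \<alpha>) {0}) \<or>
      contragredient scale part br cartan_F4 {0} \<or>
      contragredient scale part br cartan_G3 {0})"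

subsection \<open>Cartan subalgebras, roots and the Weyl group\<close>

fun lower_central ::
  "('k::field \<Rightarrow> 'g::ab_group_add \<Rightarrow> 'g) \<Rightarrow> ('g \<Rightarrow> 'g \<Rightarrow> 'g) \<Rightarrow> 'g set \<Rightarrow> nat \<Rightarrow> 'g set" where
  "lower_central scale br L 0 = L"
| "lower_central scale br L (Suc k) =
     Modules.module.span scale {br x y | x y. x \<in> L \<and> y \<in> lower_central scale br L k}"

definition cartan_subalgebra ::
  "('k::field \<Rightarrow> 'g::ab_group_add \<Rightarrow> 'g) \<Rightarrow> ('g \<Rightarrow> 'g \<Rightarrow> 'g) \<Rightarrow> 'g set \<Rightarrow> 'g set \<Rightarrow> bool" where
  "cartan_subalgebra scale br L H \<longleftrightarrow> Modules.module.subspace scale H \<and>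
     (\<forall>x\<in>H. \<forall>y\<in>H. br x y \<in> H) \<and> (\<exists>k. lower_central scale br H k = {0}) \<and>
     H \<subseteq> L \<and> {x \<in> L. \<forall>y\<in>H. br x y \<in> H} = H"

(* Functionals on H are represented by functions vanishing outside H. *)
definition dual_space :: "('k::field \<Rightarrow> 'g::ab_group_add \<Rightarrow> 'g) \<Rightarrow> 'g set \<Rightarrow> ('g \<Rightarrow> 'k) set" where
  "dual_space scale H = {l. (\<forall>x\<in>H. \<forall>y\<in>H. l (x + y) = l x + l y) \<and>
     (\<forall>c. \<forall>x\<in>H. l (scale c x) = c * l x) \<and> (\<forall>x. x \<notin> H \<longrightarrow> l x = 0)}"

definition weight_space ::
  "('k::field \<Rightarrow> 'g::ab_group_add \<Rightarrow> 'g) \<Rightarrow> ('g \<Rightarrow> 'g \<Rightarrow> 'g) \<Rightarrow> 'g set \<Rightarrow> 'g set \<Rightarrow> ('g \<Rightarrow> 'k) \<Rightarrow>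
   'g set" where
  "weight_space scale br L H \<alpha> = {x \<in> L. \<forall>y\<in>H. br y x = scale (\<alpha> y) x}"

definition roots ::
  "('k::field \<Rightarrow> 'g::ab_group_add \<Rightarrow> 'g) \<Rightarrow> ('g \<Rightarrow> 'g \<Rightarrow> 'g) \<Rightarrow> 'g set \<Rightarrow> 'g set \<Rightarrow>
   ('g \<Rightarrow> 'k) set" where
  "roots scale br L H = {\<alpha> \<in> dual_space scale H. \<alpha> \<noteq> (\<lambda>_. 0) \<and> weight_space scale br L H \<alpha> \<noteq> {0}}"

(* For a reductive Lie algebra L, the group generated by the reflections
   s(\<lambda>) = \<lambda> - \<lambda>(c) \<beta>, where \<beta> is a root and c the coroot of \<beta>, i.e. the element
   of [L_\<beta>, L_-\<beta>] with \<beta>(c) = 2. *)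
inductive_set weyl_group ::
  "('k::field \<Rightarrow> 'g::ab_group_add \<Rightarrow> 'g) \<Rightarrow> ('g \<Rightarrow> 'g \<Rightarrow> 'g) \<Rightarrow> 'g set \<Rightarrow> 'g set \<Rightarrow>
   (('g \<Rightarrow> 'k) \<Rightarrow> ('g \<Rightarrow> 'k)) set"
  for scale br L H where
  one: "id \<in> weyl_group scale br L H"
| reflection: "w \<in> weyl_group scale br L H \<Longrightarrow> \<beta> \<in> roots scale br L H \<Longrightarrow>
     u \<in> weight_space scale br L H \<beta> \<Longrightarrow> v \<in> weight_space scale br L H (\<lambda>x. - \<beta> x) \<Longrightarrow>
     c = br u v \<Longrightarrow> \<beta> c = 2 \<Longrightarrow>
     (\<lambda>l x. l x - l c * \<beta> x) \<circ> w \<in> weyl_group scale br L H"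

definition invariant_form ::
  "('k::field \<Rightarrow> 'g::ab_group_add \<Rightarrow> 'g) \<Rightarrow> (bool \<Rightarrow> 'g set) \<Rightarrow> ('g \<Rightarrow> 'g \<Rightarrow> 'g) \<Rightarrow>
   ('g \<Rightarrow> 'g \<Rightarrow> 'k) \<Rightarrow> bool" where
  "invariant_form scale part br B \<longleftrightarrow>
     (\<forall>x y z. B (x + y) z = B x z + B y z \<and> B x (y + z) = B x y + B x z) \<and>
     (\<forall>c x y. B (scale c x) y = c * B x y \<and> B x (scale c y) = c * B x y) \<and>
     (\<forall>x\<in>part False. \<forall>y\<in>part True. B x y = 0) \<and>
     (\<forall>a b. \<forall>x\<in>part a. \<forall>y\<in>part b. B y x = ssign a b * B x y) \<and>
     (\<forall>x y z. B (br x y) z = B x (br y z)) \<and>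
     (\<forall>x. (\<forall>y. B x y = 0) \<longrightarrow> x = 0)"

definition dual_form ::
  "('k::field \<Rightarrow> 'g::ab_group_add \<Rightarrow> 'g) \<Rightarrow> 'g set \<Rightarrow> ('g \<Rightarrow> 'g \<Rightarrow> 'k) \<Rightarrow>
   ('g \<Rightarrow> 'k) \<Rightarrow> ('g \<Rightarrow> 'k) \<Rightarrow> 'k" where
  "dual_form scale H B l m =
     (let t = (\<lambda>l. THE t. t \<in> H \<and> (\<forall>x\<in>H. B t x = l x)) in B (t l) (t m))"

definition isotropic_roots ::
  "('k::field \<Rightarrow> 'g::ab_group_add \<Rightarrow> 'g) \<Rightarrow> ('g \<Rightarrow> 'g \<Rightarrow> 'g) \<Rightarrow> 'g set \<Rightarrow> ('g \<Rightarrow> 'g \<Rightarrow> 'k) \<Rightarrow>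
   ('g \<Rightarrow> 'k) set" where
  "isotropic_roots scale br H B =
     {\<alpha> \<in> roots scale br UNIV H. dual_form scale H B \<alpha> \<alpha> = 0}"

definition symmetric_algebra :: "'g set \<Rightarrow> (('g \<Rightarrow> 'k::field) \<Rightarrow> 'k) set" where
  "symmetric_algebra H = fun_algebra {(\<lambda>l. l x) | x. x \<in> H}"

definition I_KM ::
  "('k::field \<Rightarrow> 'g::ab_group_add \<Rightarrow> 'g) \<Rightarrow> (bool \<Rightarrow> 'g set) \<Rightarrow> ('g \<Rightarrow> 'g \<Rightarrow> 'g) \<Rightarrow>
   ('g \<Rightarrow> 'g \<Rightarrow> 'k) \<Rightarrow> 'g set \<Rightarrow> (('g \<Rightarrow> 'k) \<Rightarrow> 'k) set" where
  "I_KM scale part br B H = {f \<in> symmetric_algebra H.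
     (\<forall>w\<in>weyl_group scale br (part False) H. \<forall>l\<in>dual_space scale H. f (w l) = f l) \<and>
     (\<forall>\<alpha>\<in>isotropic_roots scale br H B. \<forall>l\<in>dual_space scale H. dual_form scale H B l \<alpha> = 0 \<longrightarrow>
        (\<forall>t. f l = f (\<lambda>x. l x + t * \<alpha> x)))}"

subsection \<open>The queer Lie superalgebra\<close>

(* The coordinates are numbered 0, ..., n - 1. For n < 2 the last condition is void. *)
definition I_q :: "nat \<Rightarrow> ('k::field vec \<Rightarrow> 'k) set" where
  "I_q n = {f \<in> fun_algebra {(\<lambda>v. v $ i) | i. i < n}.
     (\<forall>\<pi>. \<pi> permutes {..<n} \<longrightarrow> (\<forall>v\<in>carrier_vec n. f (vec n (\<lambda>i. v $ \<pi> i)) = f v)) \<and>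
     (2 \<le> n \<longrightarrow> (\<forall>v\<in>carrier_vec n. \<forall>s t.
        f (vec n (\<lambda>i. if i = n - 1 then s else if i = n - 2 then - s else v $ i)) =
        f (vec n (\<lambda>i. if i = n - 1 then t else if i = n - 2 then - t else v $ i))))}"


section \<open>Lie supergroups\<close>

(* A matrix supergroup is given by its Harish-Chandra pair: the k-points of the even part, a closed
   subgroup of GL(mat_size), and the homogeneous parts of its Lie superalgebra. *)
record 'k supergroup =
  mat_size :: nat
  pts :: "'k mat set"
  lie :: "bool \<Rightarrow> 'k mat set"

definition GL_super :: "nat \<Rightarrow> nat \<Rightarrow> 'k::field supergroup" where
  "GL_super m n = \<lparr>mat_size = m + n,
     pts = {even_block m n A D | A D. A \<in> carrier_mat m m \<and> D \<in> carrier_mat n n \<and>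
              det A \<noteq> 0 \<and> det D \<noteq> 0},
     lie = gl_super m n\<rparr>"

definition SL_super :: "nat \<Rightarrow> nat \<Rightarrow> 'k::field supergroup" where
  "SL_super m n = \<lparr>mat_size = m + n,
     pts = {even_block m n A D | A D. A \<in> carrier_mat m m \<and> D \<in> carrier_mat n n \<and>
              det A \<noteq> 0 \<and> det D \<noteq> 0 \<and> det A = det D},
     lie = sl_super m n\<rparr>"

definition OSP_super :: "nat \<Rightarrow> nat \<Rightarrow> 'k::field supergroup" where
  "OSP_super r n = \<lparr>mat_size = r + 2*n,
     pts = {even_block r (2*n) A D | A D. A \<in> carrier_mat r r \<and> D \<in> carrier_mat (2*n) (2*n) \<and>
              transpose_mat A * sym_form r * A = sym_form r \<and> det A = 1 \<and>
              transpose_mat D * alt_form n * D = alt_form n},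
     lie = osp_super r n\<rparr>"

definition P_super :: "nat \<Rightarrow> 'k::field supergroup" where
  "P_super n = \<lparr>mat_size = n + n,
     pts = {even_block n n A D | A D. A \<in> carrier_mat n n \<and> D \<in> carrier_mat n n \<and>
              A * transpose_mat D = 1\<^sub>m n},
     lie = p_super n\<rparr>"

definition Q_super :: "nat \<Rightarrow> 'k::field supergroup" where
  "Q_super n = \<lparr>mat_size = n + n,
     pts = {even_block n n A A | A. A \<in> carrier_mat n n \<and> det A \<noteq> 0},
     lie = q_super n\<rparr>"

subsection \<open>Maximal tori\<close>

(* Generators of the coordinate ring of GL(N). *)
definition GL_coords :: "nat \<Rightarrow> ('k::field mat \<Rightarrow> 'k) set" where
  "GL_coords N = {(\<lambda>g. g $$ (i,j)) | i j. i < N \<and> j < N} \<union> {\<lambda>g. inverse (det g)}"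

definition split_torus :: "nat \<Rightarrow> 'k::field vec set" where
  "split_torus r = {t \<in> carrier_vec r. \<forall>i<r. t $ i \<noteq> 0}"

definition torus_coords :: "nat \<Rightarrow> ('k::field vec \<Rightarrow> 'k) set" where
  "torus_coords r = {(\<lambda>t. t $ i) | i. i < r} \<union> {(\<lambda>t. inverse (t $ i)) | i. i < r}"

(* T is the image of an isomorphism of algebraic groups \<phi> defined on a split torus; the last
   conjunct says that the inverse of \<phi> is regular. *)
definition is_torus :: "nat \<Rightarrow> 'k::field mat set \<Rightarrow> bool" where
  "is_torus N T \<longleftrightarrow> T \<subseteq> {g \<in> carrier_mat N N. det g \<noteq> 0} \<and>
     (\<exists>r \<phi>. bij_betw \<phi> (split_torus r) T \<and>
        (\<forall>s\<in>split_torus r. \<forall>t\<in>split_torus r. \<phi> (vec r (\<lambda>i. s $ i * t $ i)) = \<phi> s * \<phi> t) \<and>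
        (\<forall>i<N. \<forall>j<N. \<exists>f\<in>fun_algebra (torus_coords r). \<forall>t\<in>split_torus r. \<phi> t $$ (i,j) = f t) \<and>
        (\<forall>i<r. \<exists>f\<in>fun_algebra (GL_coords N). \<forall>t\<in>split_torus r. t $ i = f (\<phi> t)))"

definition maximal_torus :: "'k::field supergroup \<Rightarrow> 'k mat set \<Rightarrow> bool" where
  "maximal_torus G T \<longleftrightarrow> T \<subseteq> pts G \<and> is_torus (mat_size G) T \<and>
     (\<forall>T'. T \<subseteq> T' \<and> T' \<subseteq> pts G \<and> is_torus (mat_size G) T' \<longrightarrow> T' = T)"

subsection \<open>Modules and supercharacters\<close>

(* Regular functions f on GL(N), i.e. polynomials in the matrix entries and 1/det, together with
   their differential at the identity. *)
inductive regular_differential ::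
  "nat \<Rightarrow> ('k::field mat \<Rightarrow> 'k) \<Rightarrow> ('k mat \<Rightarrow> 'k) \<Rightarrow> bool" for N where
  const: "regular_differential N (\<lambda>_. c) (\<lambda>_. 0)"
| coord: "i < N \<Longrightarrow> j < N \<Longrightarrow> regular_differential N (\<lambda>g. g $$ (i,j)) (\<lambda>x. x $$ (i,j))"
| inv_det: "regular_differential N (\<lambda>g. inverse (det g)) (\<lambda>x. - mtrace x)"
| add: "regular_differential N f D \<Longrightarrow> regular_differential N f' D' \<Longrightarrow>
     regular_differential N (\<lambda>g. f g + f' g) (\<lambda>x. D x + D' x)"
| mult: "regular_differential N f D \<Longrightarrow> regular_differential N f' D' \<Longrightarrow>
     regular_differential N (\<lambda>g. f g * f' g) (\<lambda>x. D x * f' (1\<^sub>m N) + f (1\<^sub>m N) * D' x)"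

(* Homogeneous d x d matrices of parity a, where \<pi> i is the parity of the i-th basis vector. *)
definition graded_mats :: "nat \<Rightarrow> (nat \<Rightarrow> bool) \<Rightarrow> bool \<Rightarrow> 'k::zero mat set" where
  "graded_mats d \<pi> a =
     {A \<in> carrier_mat d d. \<forall>i<d. \<forall>j<d. A $$ (i,j) \<noteq> 0 \<longrightarrow> (\<pi> i \<noteq> \<pi> j) = a}"

(* A d-dimensional G-module in a homogeneous basis with parities \<pi>: a rational representation \<rho>
   of the even part and a representation \<sigma> of the Lie superalgebra, where \<sigma> is
   Ad-equivariant and restricts to the differential of \<rho> on the even part. *)
definition supergroup_module ::
  "'k::field supergroup \<Rightarrow> nat \<Rightarrow> (nat \<Rightarrow> bool) \<Rightarrow> ('k mat \<Rightarrow> 'k mat) \<Rightarrow> ('k mat \<Rightarrow> 'k mat) \<Rightarrow>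
   bool" where
  "supergroup_module G d \<pi> \<rho> \<sigma> \<longleftrightarrow>
     (\<forall>g\<in>pts G. \<rho> g \<in> graded_mats d \<pi> False) \<and>
     \<rho> (1\<^sub>m (mat_size G)) = 1\<^sub>m d \<and>
     (\<forall>g\<in>pts G. \<forall>h\<in>pts G. \<rho> (g * h) = \<rho> g * \<rho> h) \<and>
     (\<forall>a. \<forall>x\<in>lie G a. \<sigma> x \<in> graded_mats d \<pi> a) \<and>
     (\<forall>a. \<forall>x\<in>lie G a. \<forall>y\<in>lie G a. \<sigma> (x + y) = \<sigma> x + \<sigma> y) \<and>
     (\<forall>a. \<forall>x\<in>lie G a. \<forall>c. \<sigma> (c \<cdot>\<^sub>m x) = c \<cdot>\<^sub>m \<sigma> x) \<and>
     (\<forall>a b. \<forall>x\<in>lie G a. \<forall>y\<in>lie G b. \<sigma> (mbr a b x y) = mbr a b (\<sigma> x) (\<sigma> y)) \<and>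
     (\<forall>g\<in>pts G. \<forall>h\<in>pts G. g * h = 1\<^sub>m (mat_size G) \<longrightarrow>
        (\<forall>a. \<forall>x\<in>lie G a. \<sigma> (g * x * h) = \<rho> g * \<sigma> x * \<rho> h)) \<and>
     (\<forall>i<d. \<forall>j<d. \<exists>f D. regular_differential (mat_size G) f D \<and>
        (\<forall>g\<in>pts G. \<rho> g $$ (i,j) = f g) \<and> (\<forall>x\<in>lie G False. \<sigma> x $$ (i,j) = D x))"

(* The character e^\<mu> is the function \<mu> on the torus, so that the (super)character of a
   module is the function t \<mapsto> (super)trace of \<rho>(t). *)
definition supercharacters :: "'k::field supergroup \<Rightarrow> ('k mat \<Rightarrow> 'k) set" where
  "supercharacters G = {(\<lambda>t. \<Sum>i<d. (if \<pi> i then - 1 else 1) * \<rho> t $$ (i,i)) | d \<pi> \<rho>.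
     \<exists>\<sigma>. supergroup_module G d \<pi> \<rho> \<sigma>}"

definition characters :: "'k::field supergroup \<Rightarrow> ('k mat \<Rightarrow> 'k) set" where
  "characters G = {(\<lambda>t. \<Sum>i<d. \<rho> t $$ (i,i)) | d \<rho>.
     \<exists>\<pi> \<sigma>. supergroup_module G d \<pi> \<rho> \<sigma>}"

(* J(G) \<otimes> k inside the functions on a torus: distinct characters of a torus being linearly
   independent over k, it is the k-span of the (super)characters. *)
definition J_super :: "'k::field supergroup \<Rightarrow> ('k mat \<Rightarrow> 'k) set" where
  "J_super G = fun_span (supercharacters G)"

definition J_char :: "'k::field supergroup \<Rightarrow> ('k mat \<Rightarrow> 'k) set" where
  "J_char G = fun_span (characters G)"

end

theory Submission
  imports Defs "HOL-Library.Function_Algebras"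
begin

text \<open>
  In every case the functions in \<open>\<A>\<close> are restrictions to \<open>X\<close> of elements of a finitely generated algebra
  \<open>\<O>\<close> of functions: polynomials on a finite dimensional space, or the coordinate ring of
  a general linear group. By Hilbert's basis theorem (\<open>noetherian_adjoin\<close>, \<open>noetherian_fun_algebra\<close>)
  the algebra \<open>\<O>\<close> is Noetherian. A superalgebraic set is determined by its vanishing ideal in
  \<open>\<O>\<close>, so superalgebraic sets satisfy the descending chain condition, although \<open>\<A>\<close> itself need not be
  Noetherian. Since \<open>\<A>\<close> is closed under products, finite unions of superalgebraic sets are
  superalgebraic, and the classical argument for a Noetherian topological space yields existence
  and uniqueness of the decomposition (\<open>unique_decompositions_if_finitely_generated\<close>).

  It remains to see that \<open>\<A>\<close> is closed under products. For the rings defined by invariance conditions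
  this is immediate. For the rings spanned by characters or supercharacters it says that modules have
  tensor products (\<open>supergroup_module_tensor\<close>): the group acts by Kronecker products, the Lie
  superalgebra by the Leibniz rule with the Koszul sign. The tensor product is
  compatible with the regularity requirement because the identity is a point of the group, which
  follows from the presence of a torus (\<open>one_in_torus\<close>).
\<close>

section \<open>Noetherian subrings and Hilbert's basis theorem\<close>

text \<open>
  Subrings and ideals are plain subsets of one commutative ring, so that variables can be
  adjoined one after another without changing the type.
\<close>

definition subring_of :: "'a::comm_ring_1 set \<Rightarrow> bool" where
  "subring_of R \<longleftrightarrow> 0 \<in> R \<and> 1 \<in> R \<and>
     (\<forall>a\<in>R. \<forall>b\<in>R. a - b \<in> R \<and> a + b \<in> R \<and> a * b \<in> R)"

definition ideal_of :: "'a::comm_ring_1 set \<Rightarrow> 'a set \<Rightarrow> bool" where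
  "ideal_of R J \<longleftrightarrow> J \<subseteq> R \<and> 0 \<in> J \<and> (\<forall>a\<in>J. \<forall>b\<in>J. a + b \<in> J) \<and> (\<forall>r\<in>R. \<forall>a\<in>J. r * a \<in> J)"

text \<open>
  The ascending chain condition is what the descent on superalgebraic sets consumes, and the
  proof of Hilbert's basis theorem below passes it on without ever choosing generators.
\<close>

definition noetherian :: "'a::comm_ring_1 set \<Rightarrow> bool" where
  "noetherian R \<longleftrightarrow> (\<forall>J::nat \<Rightarrow> 'a set. (\<forall>n. ideal_of R (J n)) \<and> mono J \<longrightarrow>
     (\<exists>N. \<forall>n\<ge>N. J n = J N))"

lemma subring_ofD:
  assumes "subring_of R"
  shows "0 \<in> R" "1 \<in> R" "a \<in> R \<Longrightarrow> b \<in> R \<Longrightarrow> a + b \<in> R" "a \<in> R \<Longrightarrow> b \<in> R \<Longrightarrow> a - b \<in> R"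
    "a \<in> R \<Longrightarrow> b \<in> R \<Longrightarrow> a * b \<in> R" "- 1 \<in> R"
proof -
  have "0 - 1 \<in> R" using assms unfolding subring_of_def by blast
  then show "- 1 \<in> R" by simp
qed (use assms in \<open>auto simp: subring_of_def\<close>)

lemma ideal_ofD:
  assumes "ideal_of R J"
  shows "J \<subseteq> R" "0 \<in> J" "a \<in> J \<Longrightarrow> b \<in> J \<Longrightarrow> a + b \<in> J" "r \<in> R \<Longrightarrow> a \<in> J \<Longrightarrow> r * a \<in> J"
  using assms by (auto simp: ideal_of_def)

lemma ideal_of_diff:
  assumes "subring_of R" "ideal_of R J" "a \<in> J" "b \<in> J"
  shows "a - b \<in> J"
proof -
  have "(- 1) * b \<in> J"
    using assms by (intro ideal_ofD(4) subring_ofD(6))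
  then have "a + (- 1) * b \<in> J" using assms ideal_ofD(3) by blast
  then show ?thesis by simp
qed

text \<open>
  Polynomial expressions of degree less than \<open>d\<close> in \<open>x\<close> with coefficients in \<open>R\<close>. They are values
  in the ambient ring, not formal polynomials: \<open>x\<close> may be algebraic over \<open>R\<close> and an element may
  have several such expressions.
\<close>

primrec poly_below :: "'a::comm_ring_1 set \<Rightarrow> 'a \<Rightarrow> nat \<Rightarrow> 'a set" where
  "poly_below R x 0 = {0}"
| "poly_below R x (Suc d) = {r * x ^ d + g | r g. r \<in> R \<and> g \<in> poly_below R x d}"

lemma poly_below_SucI: "r \<in> R \<Longrightarrow> g \<in> poly_below R x d \<Longrightarrow> r * x ^ d + g \<in> poly_below R x (Suc d)"
  unfolding poly_below.simps mem_Collect_eq by (intro exI conjI) (rule refl, assumption+)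

lemma poly_below_SucE:
  assumes "f \<in> poly_below R x (Suc d)"
  obtains r g where "f = r * x ^ d + g" "r \<in> R" "g \<in> poly_below R x d"
  using assms unfolding poly_below.simps mem_Collect_eq by (elim exE conjE)

definition adjoin :: "'a::comm_ring_1 set \<Rightarrow> 'a \<Rightarrow> 'a set" where
  "adjoin R x = (\<Union>d. poly_below R x d)"

context
  fixes R :: "'a::comm_ring_1 set" and x :: 'a
  assumes R: "subring_of R"
begin

lemma poly_below_zero: "0 \<in> poly_below R x d"
proof (induction d)
  case (Suc d)
  have "0 * x ^ d + 0 \<in> poly_below R x (Suc d)"
    using Suc subring_ofD(1)[OF R] by (intro poly_below_SucI)
  then show ?case by simp
qed simp

lemma poly_below_mono: "d \<le> e \<Longrightarrow> poly_below R x d \<subseteq> poly_below R x e"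
proof (induction rule: dec_induct)
  case (step e)
  have "f \<in> poly_below R x (Suc e)" if "f \<in> poly_below R x e" for f
    using poly_below_SucI[OF subring_ofD(1)[OF R] that] by simp
  with step show ?case by blast
qed simp

lemma poly_below_add: "f \<in> poly_below R x d \<Longrightarrow> g \<in> poly_below R x d \<Longrightarrow> f + g \<in> poly_below R x d"
proof (induction d arbitrary: f g)
  case (Suc d)
  obtain r f' where f: "f = r * x ^ d + f'" "r \<in> R" "f' \<in> poly_below R x d"
    using poly_below_SucE[OF Suc.prems(1)] .
  obtain s g' where g: "g = s * x ^ d + g'" "s \<in> R" "g' \<in> poly_below R x d"
    using poly_below_SucE[OF Suc.prems(2)] .
  have "f + g = (r + s) * x ^ d + (f' + g')" by (simp add: f g algebra_simps)
  then show ?case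
    using poly_below_SucI[OF subring_ofD(3)[OF R f(2) g(2)] Suc.IH[OF f(3) g(3)]]
    by (simp only:)
qed simp

lemma poly_below_smult: "a \<in> R \<Longrightarrow> f \<in> poly_below R x d \<Longrightarrow> a * f \<in> poly_below R x d"
proof (induction d arbitrary: f)
  case (Suc d)
  obtain r g where f: "f = r * x ^ d + g" "r \<in> R" "g \<in> poly_below R x d"
    by (rule poly_below_SucE[OF Suc.prems(2)])
  have "a * f = (a * r) * x ^ d + a * g" by (simp add: f algebra_simps)
  then show ?case
    using poly_below_SucI[OF subring_ofD(5)[OF R Suc.prems(1) f(2)] Suc.IH[OF Suc.prems(1) f(3)]]
    by (simp only:)
qed simp

lemma poly_below_shift: "f \<in> poly_below R x d \<Longrightarrow> x ^ k * f \<in> poly_below R x (k + d)"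
proof (induction d arbitrary: f)
  case 0
  then show ?case using poly_below_zero by simp
next
  case (Suc d)
  obtain r g where f: "f = r * x ^ d + g" "r \<in> R" "g \<in> poly_below R x d"
    by (rule poly_below_SucE[OF Suc.prems])
  have "x ^ k * f = r * x ^ (k + d) + x ^ k * g" by (simp add: f algebra_simps power_add)
  then show ?case
    using poly_below_SucI[OF f(2) Suc.IH[OF f(3)]] by (simp only: add_Suc_right)
qed

lemma adjoin_add:
  assumes "f \<in> adjoin R x" "g \<in> adjoin R x"
  shows "f + g \<in> adjoin R x"
proof -
  obtain d e where "f \<in> poly_below R x d" "g \<in> poly_below R x e"
    using assms by (auto simp: adjoin_def)
  then have "f + g \<in> poly_below R x (max d e)"
    using poly_below_mono[of d "max d e"] poly_below_mono[of e "max d e"]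
    by (intro poly_below_add) auto
  then show ?thesis by (auto simp: adjoin_def)
qed

lemma adjoin_mult:
  assumes "f \<in> adjoin R x" and g: "g \<in> adjoin R x"
  shows "f * g \<in> adjoin R x"
proof -
  obtain e where e: "g \<in> poly_below R x e"
    using g by (auto simp: adjoin_def)
  have "f * g \<in> adjoin R x" if "f \<in> poly_below R x d" for d
    using that
  proof (induction d arbitrary: f)
    case 0
    then show ?case using poly_below_zero by (auto simp: adjoin_def)
  next
    case (Suc d)
    obtain r h where f: "f = r * x ^ d + h" "r \<in> R" "h \<in> poly_below R x d"
      by (rule poly_below_SucE[OF Suc.prems])
    have "r * (x ^ d * g) \<in> adjoin R x"
      using poly_below_smult[OF f(2) poly_below_shift[OF e]] by (auto simp: adjoin_def)
    then have "r * (x ^ d * g) + h * g \<in> adjoin R x"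
      using adjoin_add Suc.IH f by blast
    then show ?case by (simp add: f algebra_simps)
  qed
  then show ?thesis using assms by (auto simp: adjoin_def)
qed

lemma subset_adjoin: "R \<subseteq> adjoin R x"
proof
  fix r assume "r \<in> R"
  then have "r * x ^ 0 + 0 \<in> poly_below R x (Suc 0)"
    by (intro poly_below_SucI) auto
  then show "r \<in> adjoin R x"
    unfolding adjoin_def by (simp del: poly_below.simps) blast
qed

lemma gen_in_adjoin: "x \<in> adjoin R x"
proof -
  have "1 * x ^ 1 + 0 \<in> poly_below R x (Suc 1)"
    by (intro poly_below_SucI subring_ofD(2)[OF R] poly_below_zero)
  then show ?thesis unfolding adjoin_def by (simp del: poly_below.simps) blast
qed

lemma subring_adjoin: "subring_of (adjoin R x)"
proof -
  have "a - b \<in> adjoin R x" if "a \<in> adjoin R x" "b \<in> adjoin R x" for a b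
  proof -
    have "- 1 \<in> adjoin R x" using subset_adjoin subring_ofD(6)[OF R] by blast
    then have "a + (- 1) * b \<in> adjoin R x" using that by (intro adjoin_add adjoin_mult)
    then show ?thesis by simp
  qed
  then show ?thesis
    using adjoin_add adjoin_mult subset_adjoin subring_ofD(1,2)[OF R]
    by (auto simp: subring_of_def)
qed

text \<open>
  The coefficients of \<open>x ^ d\<close> over all expressions of degree at most \<open>d\<close> of elements of \<open>J\<close>. Zero
  leading coefficients are included, which makes this an ideal of \<open>R\<close>.
\<close>

definition leading :: "'a set \<Rightarrow> nat \<Rightarrow> 'a set" where
  "leading J d = {r \<in> R. \<exists>g\<in>poly_below R x d. r * x ^ d + g \<in> J}"

lemma ideal_leading:
  assumes J: "ideal_of (adjoin R x) J"
  shows "ideal_of R (leading J d)"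
proof -
  have "0 * x ^ d + 0 \<in> J" using ideal_ofD(2)[OF J] by simp
  then have "0 \<in> leading J d"
    using poly_below_zero subring_ofD(1)[OF R] unfolding leading_def by blast
  moreover have "a + b \<in> leading J d" if ab: "a \<in> leading J d" "b \<in> leading J d" for a b
  proof -
    obtain f where f: "f \<in> poly_below R x d" "a * x ^ d + f \<in> J" "a \<in> R"
      using ab(1) by (auto simp: leading_def)
    obtain g where g: "g \<in> poly_below R x d" "b * x ^ d + g \<in> J" "b \<in> R"
      using ab(2) by (auto simp: leading_def)
    have "(a + b) * x ^ d + (f + g) = (a * x ^ d + f) + (b * x ^ d + g)"
      by (simp add: algebra_simps)
    then have "(a + b) * x ^ d + (f + g) \<in> J" using ideal_ofD(3)[OF J] f g by metis
    then show ?thesis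
      using poly_below_add f g subring_ofD(3)[OF R] unfolding leading_def by blast
  qed
  moreover have "r * a \<in> leading J d" if ra: "r \<in> R" "a \<in> leading J d" for r a
  proof -
    obtain f where f: "f \<in> poly_below R x d" "a * x ^ d + f \<in> J" "a \<in> R"
      using ra(2) by (auto simp: leading_def)
    have "(r * a) * x ^ d + r * f = r * (a * x ^ d + f)" by (simp add: algebra_simps)
    moreover have "r \<in> adjoin R x" using ra(1) subset_adjoin by blast
    ultimately have "(r * a) * x ^ d + r * f \<in> J" using ideal_ofD(4)[OF J _ f(2)] by simp
    then show ?thesis
      using poly_below_smult[OF ra(1)] f ra(1) subring_ofD(5)[OF R]
      unfolding leading_def by blast
  qed
  ultimately show ?thesis by (auto simp: ideal_of_def leading_def)
qed

text \<open>
  Multiplication by a power of \<open>x\<close> raises the degree and keeps the leading coefficient.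
\<close>

lemma leading_mono_degree:
  assumes J: "ideal_of (adjoin R x) J" and "d \<le> e"
  shows "leading J d \<subseteq> leading J e"
proof
  fix r assume "r \<in> leading J d"
  then obtain g where g: "r \<in> R" "g \<in> poly_below R x d" "r * x ^ d + g \<in> J"
    by (auto simp: leading_def)
  obtain k where e: "e = k + d" using \<open>d \<le> e\<close> by (metis add.commute le_iff_add)
  have xk: "x ^ k \<in> adjoin R x"
    using subring_ofD[OF subring_adjoin] gen_in_adjoin by (induction k) auto
  have "r * x ^ e + x ^ k * g = x ^ k * (r * x ^ d + g)"
    by (simp add: e power_add algebra_simps)
  then have "r * x ^ e + x ^ k * g \<in> J" using ideal_ofD(4)[OF J xk] g by metis
  then show "r \<in> leading J e"
    using poly_below_shift[OF g(2), of k] g(1) by (auto simp: leading_def e)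
qed

text \<open>
  An element of \<open>K\<close> of degree \<open>d\<close> shares its leading coefficient with some element of \<open>J\<close>; their
  difference lies in \<open>K\<close> and has smaller degree, so the descent ends in \<open>J\<close>.
\<close>

lemma ideal_eq_if_leading_eq:
  assumes J: "ideal_of (adjoin R x) J" and K: "ideal_of (adjoin R x) K" and "J \<subseteq> K"
    and lead: "\<And>d. leading K d \<subseteq> leading J d"
  shows "J = K"
proof -
  have "f \<in> J" if "f \<in> poly_below R x d" "f \<in> K" for f d
    using that
  proof (induction d arbitrary: f)
    case 0
    then show ?case using ideal_ofD(2)[OF J] by simp
  next
    case (Suc d)
    obtain r h where f: "f = r * x ^ d + h" "r \<in> R" "h \<in> poly_below R x d"
      by (rule poly_below_SucE[OF Suc.prems(1)])
    then have "r \<in> leading K d" using Suc.prems by (auto simp: leading_def)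
    then obtain g where g: "g \<in> poly_below R x d" "r * x ^ d + g \<in> J"
      using lead by (auto simp: leading_def)
    have "f - (r * x ^ d + g) \<in> K"
      using ideal_of_diff[OF subring_adjoin K] Suc.prems g \<open>J \<subseteq> K\<close> by blast
    moreover have "f - (r * x ^ d + g) = h + (- 1) * g" by (simp add: f)
    moreover have "h + (- 1) * g \<in> poly_below R x d"
      by (intro poly_below_add poly_below_smult f g subring_ofD(6)[OF R])
    ultimately have "f - (r * x ^ d + g) \<in> J" using Suc.IH by metis
    then have "(f - (r * x ^ d + g)) + (r * x ^ d + g) \<in> J"
      using ideal_ofD(3)[OF J] g by blast
    then show ?case by simp
  qed
  then show ?thesis using \<open>J \<subseteq> K\<close> ideal_ofD(1)[OF K] by (auto simp: adjoin_def)
qed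

text \<open>
  Hilbert's basis theorem. Along an ascending chain \<open>J n\<close> the ideals of leading coefficients grow
  both in \<open>n\<close> and in the degree \<open>d\<close>. The diagonal \<open>d = n\<close> becomes constant at some \<open>N\<close>, which
  controls all degrees \<open>d \<ge> N\<close> at once; the finitely many remaining degrees become constant one
  by one. From then on all leading coefficients agree, and so do the ideals.
\<close>

theorem noetherian_adjoin:
  assumes noeth: "noetherian R"
  shows "noetherian (adjoin R x)"
  unfolding noetherian_def
proof (intro allI impI, elim conjE)
  fix J :: "nat \<Rightarrow> 'a set"
  assume "\<forall>n. ideal_of (adjoin R x) (J n)" and J_mono: "mono J"
  then have J: "ideal_of (adjoin R x) (J n)" for n by blast
  have lead_mono: "leading (J m) d \<subseteq> leading (J n) e" if "m \<le> n" "d \<le> e" for m n d e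
  proof -
    have "leading (J m) d \<subseteq> leading (J n) d"
      using monoD[OF J_mono \<open>m \<le> n\<close>] by (auto simp: leading_def)
    with leading_mono_degree[OF J \<open>d \<le> e\<close>] show ?thesis by blast
  qed
  have stab: "\<exists>N. \<forall>n\<ge>N. I n = I N" if "\<And>n. ideal_of R (I n)" "mono I" for I :: "nat \<Rightarrow> 'a set"
    using noeth that unfolding noetherian_def by blast
  have "\<exists>N. \<forall>n\<ge>N. leading (J n) n = leading (J N) N"
    using lead_mono by (intro stab ideal_leading J) (simp add: mono_def)
  then obtain N where N: "leading (J n) n = leading (J N) N" if "n \<ge> N" for n by blast
  have "\<exists>N. \<forall>n\<ge>N. leading (J n) d = leading (J N) d" for d
    using lead_mono by (intro stab ideal_leading J) (simp add: mono_def)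
  then obtain M where M: "leading (J n) d = leading (J (M d)) d" if "n \<ge> M d" for n d by metis
  \<comment> \<open>a stage after which the diagonal and all degrees below \<open>N\<close> are constant\<close>
  define m where "m = Max (insert N (M ` {..<N}))"
  have m: "N \<le> m" "d < N \<Longrightarrow> M d \<le> m" for d by (auto simp: m_def)
  have "J n = J m" if "n \<ge> m" for n
  proof (rule ideal_eq_if_leading_eq[OF J J, symmetric])
    show "J m \<subseteq> J n" using monoD[OF J_mono that] .
    fix d
    show "leading (J n) d \<subseteq> leading (J m) d"
    proof (cases "d < N")
      case True
      then show ?thesis using M[of d n] M[of d m] m(2)[of d] that by simp
    next
      case False
      have "leading (J n) d \<subseteq> leading (J (max n d)) (max n d)" by (intro lead_mono) auto
      also have "\<dots> = leading (J N) N" using False by (intro N) simp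
      also have "\<dots> \<subseteq> leading (J m) d" using False m by (intro lead_mono) auto
      finally show ?thesis .
    qed
  qed
  then show "\<exists>N. \<forall>n\<ge>N. J n = J N" by blast
qed

end

section \<open>Finitely generated algebras of functions\<close>

lemma fun_algebra_subring: "subring_of (fun_algebra (S :: ('x \<Rightarrow> 'k::comm_ring_1) set))"
proof -
  have add: "f + g \<in> fun_algebra S" if "f \<in> fun_algebra S" "g \<in> fun_algebra S" for f g
    using fun_algebra.add[OF that] by (simp add: plus_fun_def)
  have mult: "f * g \<in> fun_algebra S" if "f \<in> fun_algebra S" "g \<in> fun_algebra S" for f g
    using fun_algebra.mult[OF that] by (simp add: times_fun_def)
  have "f - g \<in> fun_algebra S" if "f \<in> fun_algebra S" "g \<in> fun_algebra S" for f g
  proof -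
    have "f + (\<lambda>_. - 1) * g \<in> fun_algebra S"
      by (intro add mult that fun_algebra.const)
    moreover have "f + (\<lambda>_. - 1) * g = f - g" by (auto simp: fun_eq_iff)
    ultimately show ?thesis by simp
  qed
  moreover have "0 \<in> fun_algebra S" "1 \<in> fun_algebra S"
    using fun_algebra.const[of 0 S] fun_algebra.const[of 1 S]
    by (simp_all add: zero_fun_def one_fun_def)
  ultimately show ?thesis using add mult by (simp add: subring_of_def)
qed

lemma fun_algebra_mono: "S \<subseteq> T \<Longrightarrow> fun_algebra S \<subseteq> fun_algebra T"
proof
  fix f assume "S \<subseteq> T" "f \<in> fun_algebra S"
  from this(2,1) show "f \<in> fun_algebra T"
    by induction (auto intro: fun_algebra.intros)
qed

text \<open>
  This makes an algebra with finitely many generators an iterated adjunction, to which Hilbert's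
  basis theorem applies step by step.
\<close>

lemma fun_algebra_insert: "fun_algebra (insert x S) = adjoin (fun_algebra S) x"
proof
  note R = fun_algebra_subring[of S] and A = subring_adjoin[OF fun_algebra_subring, of S x]
  show "fun_algebra (insert x S) \<subseteq> adjoin (fun_algebra S) x"
  proof
    fix f assume "f \<in> fun_algebra (insert x S)"
    then show "f \<in> adjoin (fun_algebra S) x"
    proof induction
      case (gen f)
      then show ?case
        using gen_in_adjoin[OF R] subset_adjoin[OF R] fun_algebra.gen[of f S]
        by (cases "f = x") auto
    next
      case (const c)
      show ?case using subset_adjoin[OF R] fun_algebra.const[of c S] by (rule subsetD)
    next
      case (add f g)
      show ?case
        using subring_ofD(3)[OF A add.IH] by (simp only: plus_fun_def)
    next
      case (mult f g)
      show ?case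
        using subring_ofD(5)[OF A mult.IH] by (simp only: times_fun_def)
    qed
  qed
  note R' = fun_algebra_subring[of "insert x S"]
  have x: "x \<in> fun_algebra (insert x S)" by (simp add: fun_algebra.gen)
  have pow: "x ^ d \<in> fun_algebra (insert x S)" for d
    by (induction d) (simp_all only: power_0 power_Suc subring_ofD(2,5)[OF R'] x)
  have sub: "fun_algebra S \<subseteq> fun_algebra (insert x S)" by (rule fun_algebra_mono) blast
  have "f \<in> fun_algebra (insert x S)" if "f \<in> poly_below (fun_algebra S) x d" for f d
    using that
  proof (induction d arbitrary: f)
    case 0
    then show ?case using subring_ofD(1)[OF R'] by (simp only: poly_below.simps singleton_iff)
  next
    case (Suc d)
    obtain r g where f: "f = r * x ^ d + g" "r \<in> fun_algebra S"
      "g \<in> poly_below (fun_algebra S) x d"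
      by (rule poly_below_SucE[OF Suc.prems])
    show ?case
      unfolding f(1) by (intro subring_ofD(3,5)[OF R'] pow Suc.IH f(3) subsetD[OF sub f(2)])
  qed
  then show "adjoin (fun_algebra S) x \<subseteq> fun_algebra (insert x S)" by (auto simp: adjoin_def)
qed

text \<open>
  The algebra generated by nothing consists of the constants, a copy of the field, whose only
  ideals are zero and the whole algebra.
\<close>

lemma noetherian_constants: "noetherian (fun_algebra ({} :: ('x \<Rightarrow> 'k::field) set))"
  unfolding noetherian_def
proof (intro allI impI, elim conjE)
  fix J :: "nat \<Rightarrow> ('x \<Rightarrow> 'k) set"
  assume "\<forall>n. ideal_of (fun_algebra {}) (J n)" and J_mono: "mono J"
  then have J: "ideal_of (fun_algebra {}) (J n)" for n by blast
  have const: "\<exists>c. f = (\<lambda>_. c)" if "f \<in> fun_algebra {}" for f :: "'x \<Rightarrow> 'k"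
    using that by induction auto
  show "\<exists>N. \<forall>n\<ge>N. J n = J N"
  proof (cases "\<forall>n. J n = {0}")
    case True
    then show ?thesis by simp
  next
    case False
    then obtain N f where f: "f \<in> J N" "f \<noteq> 0" using ideal_ofD(2)[OF J] by blast
    then obtain c where c: "f = (\<lambda>_. c)" using const ideal_ofD(1)[OF J] by blast
    with f have "c \<noteq> 0" by (auto simp: zero_fun_def)
    have "J n = fun_algebra {}" if "n \<ge> N" for n
    proof
      show "J n \<subseteq> fun_algebra {}" using ideal_ofD(1)[OF J] .
      show "fun_algebra {} \<subseteq> J n"
      proof
        fix g :: "'x \<Rightarrow> 'k" assume "g \<in> fun_algebra {}"
        then obtain d where d: "g = (\<lambda>_. d)" using const by blast
        have "(\<lambda>_. d / c) * f \<in> J n"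
          using monoD[OF J_mono that] f(1) by (intro ideal_ofD(4)[OF J] fun_algebra.const) blast
        moreover have "(\<lambda>_. d / c) * f = g" using \<open>c \<noteq> 0\<close> by (auto simp: c d)
        ultimately show "g \<in> J n" by simp
      qed
    qed
    then show ?thesis by (metis order_refl)
  qed
qed

theorem noetherian_fun_algebra:
  fixes S :: "('x \<Rightarrow> 'k::field) set"
  assumes "finite S"
  shows "noetherian (fun_algebra S)"
  using assms
proof induction
  case empty
  show ?case by (rule noetherian_constants)
next
  case (insert x S)
  then show ?case
    unfolding fun_algebra_insert by (intro noetherian_adjoin fun_algebra_subring)
qed

section \<open>Decomposition into irreducible superalgebraic sets\<close>

lemma superalgebraic_Int:
  assumes "superalgebraic X \<A> V" "superalgebraic X \<A> W"
  shows "superalgebraic X \<A> (V \<inter> W)"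
proof -
  obtain I J where "I \<subseteq> \<A>" "V = zero_locus X I" "J \<subseteq> \<A>" "W = zero_locus X J"
    using assms by (auto simp: superalgebraic_def)
  then have "I \<union> J \<subseteq> \<A>" "V \<inter> W = zero_locus X (I \<union> J)" by (auto simp: zero_locus_def)
  then show ?thesis unfolding superalgebraic_def by blast
qed

text \<open>
  The union is cut out by the products of defining functions; this is where the multiplicative
  structure of \<open>\<A>\<close> enters.
\<close>

lemma superalgebraic_Un:
  fixes \<A> :: "('x \<Rightarrow> 'k::field) set"
  assumes mult: "\<And>f g. f \<in> \<A> \<Longrightarrow> g \<in> \<A> \<Longrightarrow> (\<lambda>x. f x * g x) \<in> \<A>"
    and "superalgebraic X \<A> V" "superalgebraic X \<A> W"
  shows "superalgebraic X \<A> (V \<union> W)"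
proof -
  obtain I J where IJ: "I \<subseteq> \<A>" "V = zero_locus X I" "J \<subseteq> \<A>" "W = zero_locus X J"
    using assms(2,3) by (auto simp: superalgebraic_def)
  define K where "K = (\<lambda>(f, g) x. f x * g x) ` (I \<times> J)"
  have "K \<subseteq> \<A>" using IJ mult by (auto simp: K_def)
  moreover have "V \<union> W = zero_locus X K"
  proof
    show "V \<union> W \<subseteq> zero_locus X K" by (auto simp: IJ zero_locus_def K_def)
    show "zero_locus X K \<subseteq> V \<union> W"
    proof
      fix x assume x: "x \<in> zero_locus X K"
      then have "f x = 0 \<or> g x = 0" if "f \<in> I" "g \<in> J" for f g
        using that by (fastforce simp: zero_locus_def K_def)
      then have "(\<forall>f\<in>I. f x = 0) \<or> (\<forall>g\<in>J. g x = 0)" by blast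
      with x show "x \<in> V \<union> W" by (auto simp: IJ zero_locus_def)
    qed
  qed
  ultimately show ?thesis unfolding superalgebraic_def by blast
qed

lemma superalgebraic_Union:
  fixes \<A> :: "('x \<Rightarrow> 'k::field) set"
  assumes mult: "\<And>f g. f \<in> \<A> \<Longrightarrow> g \<in> \<A> \<Longrightarrow> (\<lambda>x. f x * g x) \<in> \<A>"
    and "finite \<C>" "\<C> \<noteq> {}" "\<And>Z. Z \<in> \<C> \<Longrightarrow> superalgebraic X \<A> Z"
  shows "superalgebraic X \<A> (\<Union>\<C>)"
  using assms(2-)
proof (induction rule: finite_ne_induct)
  case (insert Z \<C>)
  have "superalgebraic X \<A> (Z \<union> \<Union>\<C>)"
    using insert by (intro superalgebraic_Un mult) auto
  then show ?case by simp
qed simp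

text \<open>
  Intersecting \<open>Z\<close> with one member and with the union of the others splits \<open>Z\<close> into two
  superalgebraic sets, one of which has to be all of \<open>Z\<close>.
\<close>

lemma irreducible_subset_Union:
  fixes \<A> :: "('x \<Rightarrow> 'k::field) set"
  assumes mult: "\<And>f g. f \<in> \<A> \<Longrightarrow> g \<in> \<A> \<Longrightarrow> (\<lambda>x. f x * g x) \<in> \<A>"
    and irr: "irreducible_superalgebraic X \<A> Z"
    and "finite \<C>" "\<C> \<noteq> {}" "\<And>Y. Y \<in> \<C> \<Longrightarrow> superalgebraic X \<A> Y" "Z \<subseteq> \<Union>\<C>"
  shows "\<exists>Y\<in>\<C>. Z \<subseteq> Y"
  using assms(3-)
proof (induction rule: finite_ne_induct)
  case (insert Y \<C>)
  have Z: "superalgebraic X \<A> Z" using irr by (simp add: irreducible_superalgebraic_def)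
  have "superalgebraic X \<A> (\<Union>\<C>)"
    using insert by (intro superalgebraic_Union mult) auto
  then have parts: "superalgebraic X \<A> (Z \<inter> Y)" "superalgebraic X \<A> (Z \<inter> \<Union>\<C>)"
    using Z insert.prems(1) by (auto intro: superalgebraic_Int)
  have "Z = (Z \<inter> Y) \<union> (Z \<inter> \<Union>\<C>)" using insert.prems(2) by auto
  then have "Z \<inter> Y = Z \<or> Z \<inter> \<Union>\<C> = Z"
    using irr parts unfolding irreducible_superalgebraic_def by blast
  then show ?case
  proof
    assume "Z \<inter> \<Union>\<C> = Z"
    then show ?thesis using insert.IH insert.prems(1) by blast
  qed blast
qed blast

text \<open>
  Existence is Noetherian induction: a reducible set is a union of two smaller ones. Keeping only the
  maximal members of a finite decomposition makes it irredundant. For uniqueness, a member \<open>Z\<close> of one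
  irredundant decomposition lies in a member \<open>Y\<close> of the other, which lies in a member \<open>Z'\<close> of the
  first; irredundancy forces \<open>Z = Y = Z'\<close>.
\<close>

lemma unique_decompositions_if_wf:
  fixes \<A> :: "('x \<Rightarrow> 'k::field) set"
  assumes mult: "\<And>f g. f \<in> \<A> \<Longrightarrow> g \<in> \<A> \<Longrightarrow> (\<lambda>x. f x * g x) \<in> \<A>"
    and wf: "wf {(W, V). superalgebraic X \<A> W \<and> superalgebraic X \<A> V \<and> W \<subset> V}"
  shows "unique_irreducible_decompositions X \<A>"
  unfolding unique_irreducible_decompositions_def
proof (intro allI impI)
  let ?decomp = "\<lambda>V \<C>. finite \<C> \<and> \<C> \<noteq> {} \<and> (\<forall>Z\<in>\<C>. irreducible_superalgebraic X \<A> Z) \<and>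
      (\<forall>Y\<in>\<C>. \<forall>Z\<in>\<C>. Y \<noteq> Z \<longrightarrow> \<not> Y \<subseteq> Z) \<and> V = \<Union>\<C>"
  fix V assume V: "superalgebraic X \<A> V"
  have "\<exists>\<C>. finite \<C> \<and> \<C> \<noteq> {} \<and> (\<forall>Z\<in>\<C>. irreducible_superalgebraic X \<A> Z) \<and> V = \<Union>\<C>"
    using V
  proof (induction V rule: wf_induct_rule[OF wf])
    case (1 V)
    show ?case
    proof (cases "irreducible_superalgebraic X \<A> V")
      case True
      then show ?thesis by (intro exI[of _ "{V}"]) simp
    next
      case False
      then obtain V1 V2 where V12: "superalgebraic X \<A> V1" "superalgebraic X \<A> V2"
        "V1 \<subset> V" "V2 \<subset> V" "V = V1 \<union> V2"
        using 1(2) unfolding irreducible_superalgebraic_def by blast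
      obtain \<C> where \<C>: "finite \<C>" "\<C> \<noteq> {}" "\<forall>Z\<in>\<C>. irreducible_superalgebraic X \<A> Z"
        "V1 = \<Union>\<C>" using 1(1)[of V1] 1(2) V12 by auto
      obtain \<D> where \<D>: "finite \<D>" "\<D> \<noteq> {}" "\<forall>Z\<in>\<D>. irreducible_superalgebraic X \<A> Z"
        "V2 = \<Union>\<D>" using 1(1)[of V2] 1(2) V12 by auto
      show ?thesis using V12(5) \<C> \<D> by (intro exI[of _ "\<C> \<union> \<D>"]) auto
    qed
  qed
  then obtain \<C>0 where \<C>0: "finite \<C>0" "\<C>0 \<noteq> {}" "\<forall>Z\<in>\<C>0. irreducible_superalgebraic X \<A> Z"
    "V = \<Union>\<C>0" by blast
  define \<C> where "\<C> = {Z \<in> \<C>0. \<forall>Y\<in>\<C>0. Z \<subseteq> Y \<longrightarrow> Z = Y}"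
  have max: "\<exists>Y\<in>\<C>. Z \<subseteq> Y" if "Z \<in> \<C>0" for Z
    using finite_has_maximal2[OF \<C>0(1) that] by (auto simp: \<C>_def)
  have exist: "?decomp V \<C>"
  proof (intro conjI)
    show "\<C> \<noteq> {}" using max \<C>0(2) by blast
    have "\<Union>\<C>0 \<subseteq> \<Union>\<C>" using max by blast
    moreover have "\<Union>\<C> \<subseteq> \<Union>\<C>0" unfolding \<C>_def by blast
    ultimately show "V = \<Union>\<C>" unfolding \<C>0(4) by (rule subset_antisym)
    show "finite \<C>" using \<C>0(1) by (simp add: \<C>_def)
    show "\<forall>Z\<in>\<C>. irreducible_superalgebraic X \<A> Z" using \<C>0(3) by (simp add: \<C>_def)
    show "\<forall>Y\<in>\<C>. \<forall>Z\<in>\<C>. Y \<noteq> Z \<longrightarrow> \<not> Y \<subseteq> Z" unfolding \<C>_def by blast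
  qed
  have sa: "superalgebraic X \<A> Z" if "irreducible_superalgebraic X \<A> Z" for Z
    using that by (simp add: irreducible_superalgebraic_def)
  have below: "\<exists>Y\<in>\<E>. Z \<subseteq> Y"
    if Z: "irreducible_superalgebraic X \<A> Z" "Z \<subseteq> V" and E: "?decomp V \<E>" for Z \<E>
  proof (rule irreducible_subset_Union[OF mult Z(1)])
    show "finite \<E>" "\<E> \<noteq> {}" using E by simp_all
    show "superalgebraic X \<A> Y" if "Y \<in> \<E>" for Y using E that by (intro sa) simp
    show "Z \<subseteq> \<Union>\<E>" using E Z(2) by simp
  qed
  have sub: "\<C> \<subseteq> \<D>" if C: "?decomp V \<C>" and D: "?decomp V \<D>" for \<C> \<D>
  proof
    fix Z assume Z: "Z \<in> \<C>"
    have "irreducible_superalgebraic X \<A> Z" "Z \<subseteq> V" using C Z by blast+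
    then obtain Y where Y: "Y \<in> \<D>" "Z \<subseteq> Y" using below[OF _ _ D] by meson
    have "irreducible_superalgebraic X \<A> Y" "Y \<subseteq> V" using D Y by blast+
    then obtain Z' where Z': "Z' \<in> \<C>" "Y \<subseteq> Z'" using below[OF _ _ C] by meson
    have "Z \<subseteq> Z'" using Y(2) Z'(2) by (rule subset_trans)
    then have "Z = Z'" using C Z Z'(1) by meson
    then show "Z \<in> \<D>" using Y Z'(2) by (metis subset_antisym)
  qed
  show "\<exists>!\<C>. ?decomp V \<C>"
  proof (rule ex1I)
    show "?decomp V \<C>" by (rule exist)
    fix \<D> assume "?decomp V \<D>"
    then show "\<D> = \<C>" by (intro subset_antisym sub exist)
  qed
qed

text \<open>
  The ambient ring \<open>fun_algebra S\<close> is Noetherian, whereas \<open>\<A>\<close> itself need not be: for superalgebras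
  the ring of invariants is typically not finitely generated. It suffices to compare vanishing
  ideals in the ambient ring. The functions in \<open>\<A>\<close> only have to agree on \<open>X\<close> with members of the
  ambient ring, since outside \<open>X\<close> their values are irrelevant.
\<close>

theorem unique_decompositions_if_finitely_generated:
  fixes \<A> :: "('x \<Rightarrow> 'k::field) set"
  assumes fin: "finite S"
    and gen: "\<And>f. f \<in> \<A> \<Longrightarrow> \<exists>g\<in>fun_algebra S. \<forall>x\<in>X. f x = g x"
    and mult: "\<And>f g. f \<in> \<A> \<Longrightarrow> g \<in> \<A> \<Longrightarrow> (\<lambda>x. f x * g x) \<in> \<A>"
  shows "unique_irreducible_decompositions X \<A>"
proof (rule unique_decompositions_if_wf[OF mult])
  define ideal where "ideal V = {g \<in> fun_algebra S. \<forall>x\<in>V. g x = 0}" for V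
  have ideal: "ideal_of (fun_algebra S) (ideal V)" for V
    using subring_ofD[OF fun_algebra_subring[of S]] by (auto simp: ideal_of_def ideal_def)
  \<comment> \<open>a superalgebraic set is determined by its vanishing ideal in the ambient ring\<close>
  have recover: "V = {x \<in> X. \<forall>g\<in>ideal V. g x = 0}" if V: "superalgebraic X \<A> V" for V
  proof -
    obtain I where I: "I \<subseteq> \<A>" "V = zero_locus X I"
      using V by (auto simp: superalgebraic_def)
    show ?thesis
    proof (intro subset_antisym subsetI)
      fix x assume x: "x \<in> {x \<in> X. \<forall>g\<in>ideal V. g x = 0}"
      have "f x = 0" if f: "f \<in> I" for f
      proof -
        obtain g where g: "g \<in> fun_algebra S" "\<forall>y\<in>X. f y = g y"
          using gen[of f] f I(1) by blast
        then have "g \<in> ideal V" using f I(2) by (auto simp: ideal_def zero_locus_def)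
        then show ?thesis using g x by simp
      qed
      then show "x \<in> V" using x I(2) by (simp add: zero_locus_def)
    qed (use I in \<open>auto simp: ideal_def zero_locus_def\<close>)
  qed
  show "wf {(W, V). superalgebraic X \<A> W \<and> superalgebraic X \<A> V \<and> W \<subset> V}"
    unfolding wf_iff_no_infinite_down_chain
  proof
    assume "\<exists>V. \<forall>i. (V (Suc i), V i) \<in> {(W, V). superalgebraic X \<A> W \<and> superalgebraic X \<A> V \<and> W \<subset> V}"
    then obtain V where V: "\<And>i. superalgebraic X \<A> (V i)" "\<And>i. V (Suc i) \<subset> V i"
      by blast
    have "V j \<subseteq> V i" if "i \<le> j" for i j
      using lift_Suc_antimono_le[of V] V(2) that by blast
    then have "ideal (V i) \<subseteq> ideal (V j)" if "i \<le> j" for i j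
      using that unfolding ideal_def by blast
    then have "(\<forall>n. ideal_of (fun_algebra S) (ideal (V n))) \<and> mono (\<lambda>n. ideal (V n))"
      using ideal by (simp add: mono_def)
    then obtain N where "\<forall>n\<ge>N. ideal (V n) = ideal (V N)"
      using noetherian_fun_algebra[OF fin, unfolded noetherian_def, THEN spec, THEN mp] by meson
    then have same: "ideal (V (Suc N)) = ideal (V N)" using le_SucI[OF order_refl] by blast
    have "V (Suc N) = {x \<in> X. \<forall>g\<in>ideal (V (Suc N)). g x = 0}" by (rule recover[OF V(1)])
    also have "\<dots> = V N" unfolding same by (rule recover[OF V(1), symmetric])
    finally have "V (Suc N) = V N" .
    then show False using V(2)[of N] by simp
  qed
qed

section \<open>Tensor products of supergroup modules\<close>

text \<open>
  The basis vector \<open>e\<^sub>i \<otimes> e\<^sub>j\<close> of a tensor product of spaces of dimensions \<open>m\<close> and \<open>n\<close> gets the index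
  \<open>i * n + j\<close>, from which \<open>div\<close> and \<open>mod\<close> recover \<open>i\<close> and \<open>j\<close>.
\<close>

lemma sum_div_mod:
  fixes f :: "nat \<Rightarrow> nat \<Rightarrow> 'a::comm_monoid_add"
  shows "(\<Sum>p<m * n. f (p div n) (p mod n)) = (\<Sum>i<m. \<Sum>j<n. f i j)"
proof -
  have "(\<Sum>p<m * n. f (p div n) (p mod n)) = (\<Sum>i<m. \<Sum>p = i * n..<i * n + n. f (p div n) (p mod n))"
    by (rule sum.nat_group[symmetric])
  also have "\<dots> = (\<Sum>i<m. \<Sum>j<n. f i j)"
  proof (rule sum.cong)
    fix i
    have "(\<Sum>p = i * n..<i * n + n. f (p div n) (p mod n)) =
        (\<Sum>j<n. f ((i * n + j) div n) ((i * n + j) mod n))"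
      by (subst sum.atLeastLessThan_shift_0) (simp add: atLeast0LessThan)
    then show "(\<Sum>p = i * n..<i * n + n. f (p div n) (p mod n)) = (\<Sum>j<n. f i j)"
      by simp
  qed simp
  finally show ?thesis .
qed

lemma div_mod_less:
  fixes p :: nat
  assumes "p < m * n"
  shows "p div n < m" "p mod n < n"
  using assms by (simp add: less_mult_imp_div_less) (cases "n = 0", use assms in auto)

text \<open>
  The Kronecker product, with explicit sizes: a representation is evaluated also at matrices
  outside the group, where nothing is known about the size of its value, and characters
  are to be multiplicative there as well.
\<close>

definition kron :: "nat \<Rightarrow> nat \<Rightarrow> 'k::comm_ring_1 mat \<Rightarrow> 'k mat \<Rightarrow> 'k mat" where
  "kron d d' A B = mat (d * d') (d * d')
     (\<lambda>(p, q). A $$ (p div d', q div d') * B $$ (p mod d', q mod d'))"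

lemma kron_carrier [simp]: "kron d d' A B \<in> carrier_mat (d * d') (d * d')"
  by (simp add: kron_def)

lemma kron_dim [simp]: "dim_row (kron d d' A B) = d * d'" "dim_col (kron d d' A B) = d * d'"
  by (simp_all add: kron_def)

lemma index_kron [simp]:
  "p < d * d' \<Longrightarrow> q < d * d' \<Longrightarrow>
     kron d d' A B $$ (p, q) = A $$ (p div d', q div d') * B $$ (p mod d', q mod d')"
  by (simp add: kron_def)

lemma index_mult_mat_sum:
  assumes "A \<in> carrier_mat n n" "B \<in> carrier_mat n n" "i < n" "k < n"
  shows "(A * B) $$ (i, k) = (\<Sum>j<n. A $$ (i, j) * B $$ (j, k))"
  using assms by (simp add: scalar_prod_def atLeast0LessThan)

lemma kron_mult:
  assumes A: "A \<in> carrier_mat d d" "C \<in> carrier_mat d d"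
    and B: "B \<in> carrier_mat d' d'" "D \<in> carrier_mat d' d'"
  shows "kron d d' A B * kron d d' C D = kron d d' (A * C) (B * D)"
proof (rule eq_matI)
  fix p q assume "p < dim_row (kron d d' (A * C) (B * D))" "q < dim_col (kron d d' (A * C) (B * D))"
  then have pq: "p < d * d'" "q < d * d'" by simp_all
  let ?i = "p div d'" and ?j = "p mod d'" and ?k = "q div d'" and ?l = "q mod d'"
  note b = div_mod_less[OF pq(1)] div_mod_less[OF pq(2)]
  have "(kron d d' A B * kron d d' C D) $$ (p, q) =
      (\<Sum>r<d * d'. (A $$ (?i, r div d') * B $$ (?j, r mod d')) * (C $$ (r div d', ?k) * D $$ (r mod d', ?l)))"
    using pq by (subst index_mult_mat_sum[OF kron_carrier kron_carrier]) simp_all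
  also have "\<dots> = (\<Sum>s<d. \<Sum>t<d'. (A $$ (?i, s) * B $$ (?j, t)) * (C $$ (s, ?k) * D $$ (t, ?l)))"
    by (rule sum_div_mod)
  also have "\<dots> = (\<Sum>s<d. A $$ (?i, s) * C $$ (s, ?k)) * (\<Sum>t<d'. B $$ (?j, t) * D $$ (t, ?l))"
    by (simp add: sum_product mult_ac)
  also have "\<dots> = (A * C) $$ (?i, ?k) * (B * D) $$ (?j, ?l)"
    using b by (simp only: index_mult_mat_sum[OF A] index_mult_mat_sum[OF B])
  finally show "(kron d d' A B * kron d d' C D) $$ (p, q) = kron d d' (A * C) (B * D) $$ (p, q)"
    using pq by simp
qed simp_all

lemma kron_one: "kron d d' (1\<^sub>m d) (1\<^sub>m d') = 1\<^sub>m (d * d')"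
proof (rule eq_matI)
  fix p q assume "p < dim_row (1\<^sub>m (d * d'))" "q < dim_col (1\<^sub>m (d * d'))"
  then have pq: "p < d * d'" "q < d * d'" by simp_all
  have "p = q \<longleftrightarrow> p div d' = q div d' \<and> p mod d' = q mod d'" by (metis div_mult_mod_eq)
  then show "kron d d' (1\<^sub>m d) (1\<^sub>m d') $$ (p, q) = 1\<^sub>m (d * d') $$ (p, q)"
    using pq div_mod_less[OF pq(1)] div_mod_less[OF pq(2)] by auto
qed simp_all

text \<open>
  The operator \<open>v \<mapsto> (-1) ^ (a * |v|) v\<close> on homogeneous \<open>v\<close>: the Koszul sign of moving an operator of
  parity \<open>a\<close> past a vector of the first tensor factor.
\<close>

definition sign_mat :: "nat \<Rightarrow> (nat \<Rightarrow> bool) \<Rightarrow> bool \<Rightarrow> 'k::comm_ring_1 mat" where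
  "sign_mat d \<pi> a = mat d d (\<lambda>(i, k). if i = k then ssign (\<pi> i) a else 0)"

lemma sign_mat_carrier [simp]: "sign_mat d \<pi> a \<in> carrier_mat d d"
  by (simp add: sign_mat_def)

lemma index_sign_mat [simp]:
  "i < d \<Longrightarrow> k < d \<Longrightarrow> sign_mat d \<pi> a $$ (i, k) = (if i = k then ssign (\<pi> i) a else 0)"
  by (simp add: sign_mat_def)

lemma sign_mat_mult_left:
  assumes "A \<in> carrier_mat d d" "i < d" "k < d"
  shows "(sign_mat d \<pi> a * A) $$ (i, k) = ssign (\<pi> i) a * A $$ (i, k)"
proof -
  have "(sign_mat d \<pi> a * A) $$ (i, k) = (\<Sum>j<d. if i = j then ssign (\<pi> i) a * A $$ (j, k) else 0)"
    unfolding index_mult_mat_sum[OF sign_mat_carrier assms]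
    by (intro sum.cong refl) (use assms in auto)
  then show ?thesis using assms by simp
qed

lemma sign_mat_mult_right:
  assumes "A \<in> carrier_mat d d" "i < d" "k < d"
  shows "(A * sign_mat d \<pi> a) $$ (i, k) = A $$ (i, k) * ssign (\<pi> k) a"
proof -
  have "(A * sign_mat d \<pi> a) $$ (i, k) = (\<Sum>j<d. if j = k then A $$ (i, j) * ssign (\<pi> k) a else 0)"
    unfolding index_mult_mat_sum[OF assms(1) sign_mat_carrier assms(2,3)]
    by (intro sum.cong refl) (use assms in auto)
  then show ?thesis using assms by simp
qed

lemma graded_matsD:
  assumes "A \<in> graded_mats d \<pi> a"
  shows "A \<in> carrier_mat d d" "i < d \<Longrightarrow> k < d \<Longrightarrow> (\<pi> i \<noteq> \<pi> k) \<noteq> a \<Longrightarrow> A $$ (i, k) = 0"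
  using assms by (auto simp: graded_mats_def)

text \<open>
  An operator of parity \<open>b\<close> shifts the parity of vectors by \<open>b\<close>, hence changes the Koszul sign for \<open>a\<close>
  by \<open>(-1) ^ (a * b)\<close>.
\<close>

lemma sign_mat_commute:
  assumes "A \<in> graded_mats d \<pi> b"
  shows "sign_mat d \<pi> a * A = ssign a b \<cdot>\<^sub>m (A * sign_mat d \<pi> a)"
proof (rule eq_matI)
  note A = graded_matsD[OF assms]
  fix i k assume "i < dim_row (ssign a b \<cdot>\<^sub>m (A * sign_mat d \<pi> a))"
    "k < dim_col (ssign a b \<cdot>\<^sub>m (A * sign_mat d \<pi> a))"
  then have ik: "i < d" "k < d" using A(1) by (simp_all add: sign_mat_def)
  have "(ssign a b \<cdot>\<^sub>m (A * sign_mat d \<pi> a)) $$ (i, k) = ssign a b * (A $$ (i, k) * ssign (\<pi> k) a)"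
    using ik A(1) sign_mat_mult_right[OF A(1) ik, of \<pi> a]
    by (subst index_smult_mat) (auto simp: sign_mat_def)
  moreover have "ssign (\<pi> i) a * A $$ (i, k) = ssign a b * (A $$ (i, k) * ssign (\<pi> k) a)"
    using A(2)[OF ik] by (cases "(\<pi> i \<noteq> \<pi> k) = b") (auto simp: ssign_def)
  ultimately show "(sign_mat d \<pi> a * A) $$ (i, k) = (ssign a b \<cdot>\<^sub>m (A * sign_mat d \<pi> a)) $$ (i, k)"
    by (simp only: sign_mat_mult_left[OF A(1) ik])
qed (use graded_matsD(1)[OF assms] in \<open>auto simp: sign_mat_def\<close>)

lemma sign_mat_mult: "sign_mat d \<pi> a * sign_mat d \<pi> b = sign_mat d \<pi> (a \<noteq> b)"
proof (rule eq_matI)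
  fix i k assume "i < dim_row (sign_mat d \<pi> (a \<noteq> b) :: 'a mat)" "k < dim_col (sign_mat d \<pi> (a \<noteq> b) :: 'a mat)"
  then have ik: "i < d" "k < d" by (simp_all add: sign_mat_def)
  show "(sign_mat d \<pi> a * sign_mat d \<pi> b) $$ (i, k) = (sign_mat d \<pi> (a \<noteq> b) :: 'a mat) $$ (i, k)"
    unfolding sign_mat_mult_left[OF sign_mat_carrier ik] using ik by (auto simp: ssign_def)
qed (simp_all add: sign_mat_def)

lemma graded_mats_mult:
  fixes A :: "'k::comm_ring_1 mat"
  assumes "A \<in> graded_mats d \<pi> a" "B \<in> graded_mats d \<pi> b"
  shows "A * B \<in> graded_mats d \<pi> (a \<noteq> b)"
proof -
  note A = graded_matsD[OF assms(1)] and B = graded_matsD[OF assms(2)]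
  have "(A * B) $$ (i, k) = 0" if ik: "i < d" "k < d" and par: "(\<pi> i \<noteq> \<pi> k) \<noteq> (a \<noteq> b)" for i k
  proof -
    have "A $$ (i, j) * B $$ (j, k) = 0" if "j < d" for j
      using A(2)[OF ik(1) that] B(2)[OF that ik(2)] par
      by (cases "\<pi> i"; cases "\<pi> j"; cases "\<pi> k"; cases a; cases b) simp_all
    then show ?thesis unfolding index_mult_mat_sum[OF A(1) B(1) ik] by (intro sum.neutral) simp
  qed
  then show ?thesis using A(1) B(1) by (fastforce simp: graded_mats_def)
qed

lemma graded_mats_mbr:
  assumes "A \<in> graded_mats d \<pi> a" "B \<in> graded_mats d \<pi> b"
  shows "mbr a b A B \<in> graded_mats d \<pi> (a \<noteq> b)"
proof -
  have BA: "B * A \<in> graded_mats d \<pi> (a \<noteq> b)"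
    using graded_mats_mult[OF assms(2,1)] by (simp add: eq_commute)
  note P = graded_matsD[OF graded_mats_mult[OF assms]] and Q = graded_matsD[OF BA]
  have "mbr a b A B $$ (i, k) = 0" if ik: "i < d" "k < d" "(\<pi> i \<noteq> \<pi> k) \<noteq> (a \<noteq> b)" for i k
    unfolding mbr_def using P(2)[OF ik] Q(2)[OF ik] ik(1,2)
      graded_matsD(1)[OF assms(1)] graded_matsD(1)[OF assms(2)]
    by (simp del: index_mult_mat(1))
  moreover have "mbr a b A B \<in> carrier_mat d d"
    unfolding mbr_def using P(1) Q(1) by (metis minus_carrier_mat smult_carrier_mat)
  ultimately show ?thesis unfolding graded_mats_def by blast
qed

text \<open>
  The action \<open>x (v \<otimes> w) = x v \<otimes> w + (-1) ^ (|x| * |v|) v \<otimes> x w\<close> of the Lie superalgebra, where \<open>A\<close> and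
  \<open>B\<close> are the matrices of \<open>x\<close> on the two factors. The action map of a module sees only the matrix \<open>x\<close>
  and not its parity, so the parity of \<open>x\<close> is read off from the position of an entry of \<open>B\<close>: a
  homogeneous \<open>B\<close> vanishes at all positions where this would give the wrong answer.
\<close>

definition tensor_action ::
  "nat \<Rightarrow> (nat \<Rightarrow> bool) \<Rightarrow> nat \<Rightarrow> (nat \<Rightarrow> bool) \<Rightarrow> 'k::comm_ring_1 mat \<Rightarrow> 'k mat \<Rightarrow> 'k mat" where
  "tensor_action d \<pi> d' \<pi>' A B = mat (d * d') (d * d') (\<lambda>(p, q).
     A $$ (p div d', q div d') * (if p mod d' = q mod d' then 1 else 0) +
     (if p div d' = q div d' then ssign (\<pi> (p div d')) (\<pi>' (p mod d') \<noteq> \<pi>' (q mod d')) else 0) *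
       B $$ (p mod d', q mod d'))"

lemma tensor_action_carrier [simp]:
  "tensor_action d \<pi> d' \<pi>' A B \<in> carrier_mat (d * d') (d * d')"
  by (simp add: tensor_action_def)

lemma tensor_action_eq_kron:
  assumes "B \<in> graded_mats d' \<pi>' a"
  shows "tensor_action d \<pi> d' \<pi>' A B = kron d d' A (1\<^sub>m d') + kron d d' (sign_mat d \<pi> a) B"
proof (rule eq_matI)
  fix p q assume "p < dim_row (kron d d' A (1\<^sub>m d') + kron d d' (sign_mat d \<pi> a) B)"
    "q < dim_col (kron d d' A (1\<^sub>m d') + kron d d' (sign_mat d \<pi> a) B)"
  then have pq: "p < d * d'" "q < d * d'" by simp_all
  note b = div_mod_less[OF pq(1)] div_mod_less[OF pq(2)]
  show "tensor_action d \<pi> d' \<pi>' A B $$ (p, q) =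
      (kron d d' A (1\<^sub>m d') + kron d d' (sign_mat d \<pi> a) B) $$ (p, q)"
    using pq b graded_matsD(2)[OF assms b(2,4)]
    by (cases "(\<pi>' (p mod d') \<noteq> \<pi>' (q mod d')) = a") (auto simp: tensor_action_def)
qed (simp_all add: tensor_action_def)

text \<open>
  Of the mixed products, those moving \<open>X\<close> past \<open>Y'\<close> and \<open>Y\<close> past \<open>X'\<close> cancel in the superbracket because
  commuting with the Koszul sign produces precisely the sign of the bracket.
\<close>

lemma tensor_action_mbr:
  fixes X Y X' Y' :: "'k::comm_ring_1 mat"
  assumes X: "X \<in> graded_mats d \<pi> a" and Y: "Y \<in> graded_mats d \<pi> b"
    and X': "X' \<in> graded_mats d' \<pi>' a" and Y': "Y' \<in> graded_mats d' \<pi>' b"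
  shows "tensor_action d \<pi> d' \<pi>' (mbr a b X Y) (mbr a b X' Y') =
    mbr a b (tensor_action d \<pi> d' \<pi>' X X') (tensor_action d \<pi> d' \<pi>' Y Y')"
proof -
  note [simp] = graded_matsD(1)[OF X] graded_matsD(1)[OF Y] graded_matsD(1)[OF X'] graded_matsD(1)[OF Y']
  let ?k = "kron d d'" and ?S = "sign_mat d \<pi> :: bool \<Rightarrow> 'k mat" and ?I = "1\<^sub>m d' :: 'k mat"
  let ?s = "ssign a b :: 'k"
  \<comment> \<open>the products are named to keep the entrywise comparison from expanding them\<close>
  define P where "P = X * ?S b"
  define Q where "Q = Y * ?S a"
  define XY where "XY = X * Y"
  define YX where "YX = Y * X"
  define XY' where "XY' = X' * Y'"
  define YX' where "YX' = Y' * X'"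
  have carr: "P \<in> carrier_mat d d" "Q \<in> carrier_mat d d" "XY \<in> carrier_mat d d" "YX \<in> carrier_mat d d"
    "XY' \<in> carrier_mat d' d'" "YX' \<in> carrier_mat d' d'"
    unfolding P_def Q_def XY_def YX_def XY'_def YX'_def by (simp_all add: mult_carrier_mat[where n=d] mult_carrier_mat[where n=d'])
  have comm: "?S a * Y = ?s \<cdot>\<^sub>m Q" "?S b * X = ?s \<cdot>\<^sub>m P"
    using sign_mat_commute[OF Y, of a] sign_mat_commute[OF X, of b]
    by (simp_all add: P_def Q_def ssign_def conj_commute)
  have expand: "(?k U ?I + ?k (?S u) U') * (?k V ?I + ?k (?S v) V') =
      (?k (U * V) ?I + ?k (?S u * V) U') + (?k (U * ?S v) V' + ?k (?S (u \<noteq> v)) (U' * V'))"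
    if "U \<in> carrier_mat d d" "V \<in> carrier_mat d d" "U' \<in> carrier_mat d' d'" "V' \<in> carrier_mat d' d'"
    for U V U' V' u v
  proof -
    have "(?k U ?I + ?k (?S u) U') * (?k V ?I + ?k (?S v) V') =
       (?k U ?I * ?k V ?I + ?k (?S u) U' * ?k V ?I) + (?k U ?I * ?k (?S v) V' + ?k (?S u) U' * ?k (?S v) V')"
      by (simp add: add_mult_distrib_mat[where nr="d*d'" and n="d*d'" and nc="d*d'"]
          mult_add_distrib_mat[where nr="d*d'" and n="d*d'" and nc="d*d'"])
    then show ?thesis
      using that by (simp add: kron_mult sign_mat_mult)
  qed
  have "tensor_action d \<pi> d' \<pi>' (mbr a b X Y) (mbr a b X' Y') =
      ?k (XY - ?s \<cdot>\<^sub>m YX) ?I + ?k (?S (a \<noteq> b)) (XY' - ?s \<cdot>\<^sub>m YX')"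
    unfolding tensor_action_eq_kron[OF graded_mats_mbr[OF X' Y']]
    by (simp add: mbr_def XY_def YX_def XY'_def YX'_def)
  also have "\<dots> = ((?k XY ?I + ?k (?s \<cdot>\<^sub>m Q) X') + (?k P Y' + ?k (?S (a \<noteq> b)) XY')) -
      ?s \<cdot>\<^sub>m ((?k YX ?I + ?k (?s \<cdot>\<^sub>m P) Y') + (?k Q X' + ?k (?S (a \<noteq> b)) YX'))"
    (is "?L = ?R")
  proof (rule eq_matI)
    fix p q assume "p < dim_row ?R" "q < dim_col ?R"
    then have pq: "p < d * d'" "q < d * d'" by simp_all
    note b = div_mod_less[OF pq(1)] div_mod_less[OF pq(2)]
    have s: "?s * (?s * z) = z" for z by (simp add: ssign_def)
    show "?L $$ (p, q) = ?R $$ (p, q)"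
      using pq b carr by (simp add: algebra_simps s)
  qed simp_all
  also have "\<dots> = mbr a b (tensor_action d \<pi> d' \<pi>' X X') (tensor_action d \<pi> d' \<pi>' Y Y')"
    unfolding tensor_action_eq_kron[OF X'] tensor_action_eq_kron[OF Y'] mbr_def
    by (simp add: expand comm P_def[symmetric] Q_def[symmetric] XY_def[symmetric] YX_def[symmetric]
        XY'_def[symmetric] YX'_def[symmetric] eq_commute[of b a])
  finally show ?thesis .
qed

text \<open>
  Elements of the even part preserve parity and therefore commute with the Koszul sign.
\<close>

lemma tensor_action_conj:
  fixes X X' :: "'k::comm_ring_1 mat"
  assumes X: "X \<in> carrier_mat d d" and X': "X' \<in> graded_mats d' \<pi>' a"
    and g: "g \<in> graded_mats d \<pi> False" and h: "h \<in> carrier_mat d d" and gh: "g * h = 1\<^sub>m d"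
    and g': "g' \<in> graded_mats d' \<pi>' False" and h': "h' \<in> graded_mats d' \<pi>' False"
    and gh': "g' * h' = 1\<^sub>m d'"
  shows "tensor_action d \<pi> d' \<pi>' (g * X * h) (g' * X' * h') =
    kron d d' g g' * tensor_action d \<pi> d' \<pi>' X X' * kron d d' h h'"
proof -
  let ?k = "kron d d'" and ?S = "sign_mat d \<pi> a :: 'k mat" and ?I = "1\<^sub>m d' :: 'k mat"
  note [simp] = X h graded_matsD(1)[OF X'] graded_matsD(1)[OF g] graded_matsD(1)[OF g'] graded_matsD(1)[OF h']
  have conj: "g' * X' * h' \<in> graded_mats d' \<pi>' a"
    using graded_mats_mult[OF graded_mats_mult[OF g' X'] h'] by simp
  have one: "1 \<cdot>\<^sub>m M = M" for M :: "'k mat" by (rule eq_matI) simp_all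
  have "g * ?S * h = ?S * g * h"
    using sign_mat_commute[OF g, of a] by (simp add: ssign_def one)
  also have "\<dots> = ?S"
    by (subst assoc_mult_mat[of _ d d _ d _ d]) (simp_all add: gh right_mult_one_mat[OF sign_mat_carrier])
  finally have S: "g * ?S * h = ?S" .
  have [simp]: "g * X \<in> carrier_mat d d" "g * ?S \<in> carrier_mat d d" "g' * X' \<in> carrier_mat d' d'"
    by (simp_all add: mult_carrier_mat[where n=d] mult_carrier_mat[where n=d'])
  have "?k g g' * (?k X ?I + ?k ?S X') * ?k h h' =
      (?k g g' * ?k X ?I + ?k g g' * ?k ?S X') * ?k h h'"
    by (simp add: mult_add_distrib_mat[where nr="d*d'" and n="d*d'" and nc="d*d'"])
  also have "\<dots> = ?k (g * X) g' * ?k h h' + ?k (g * ?S) (g' * X') * ?k h h'"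
    by (simp add: kron_mult add_mult_distrib_mat[where nr="d*d'" and n="d*d'" and nc="d*d'"]
        right_mult_one_mat[OF graded_matsD(1)[OF g']])
  also have "\<dots> = ?k (g * X * h) ?I + ?k ?S (g' * X' * h')"
    by (simp add: kron_mult S gh')
  finally show ?thesis
    unfolding tensor_action_eq_kron[OF X'] tensor_action_eq_kron[OF conj] by simp
qed

lemma tensor_action_graded:
  assumes "A \<in> graded_mats d \<pi> a" "B \<in> graded_mats d' \<pi>' a"
  shows "tensor_action d \<pi> d' \<pi>' A B \<in> graded_mats (d * d') (\<lambda>p. \<pi> (p div d') \<noteq> \<pi>' (p mod d')) a"
proof -
  have "tensor_action d \<pi> d' \<pi>' A B $$ (p, q) = 0"
    if pq: "p < d * d'" "q < d * d'"
      and par: "((\<pi> (p div d') \<noteq> \<pi>' (p mod d')) \<noteq> (\<pi> (q div d') \<noteq> \<pi>' (q mod d'))) \<noteq> a" for p q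
  proof -
    note b = div_mod_less[OF pq(1)] div_mod_less[OF pq(2)]
    show ?thesis
      using graded_matsD(2)[OF assms(1) b(1,3)] graded_matsD(2)[OF assms(2) b(2,4)] par pq
      by (cases "\<pi> (p div d')"; cases "\<pi> (q div d')"; cases "\<pi>' (p mod d')"; cases "\<pi>' (q mod d')"; cases a)
        (auto simp: tensor_action_def)
  qed
  then show ?thesis unfolding graded_mats_def using tensor_action_carrier by blast
qed

lemma kron_graded:
  assumes "A \<in> graded_mats d \<pi> False" "B \<in> graded_mats d' \<pi>' False"
  shows "kron d d' A B \<in> graded_mats (d * d') (\<lambda>p. \<pi> (p div d') \<noteq> \<pi>' (p mod d')) False"
proof -
  have "kron d d' A B $$ (p, q) = 0"
    if pq: "p < d * d'" "q < d * d'"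
      and par: "(\<pi> (p div d') \<noteq> \<pi>' (p mod d')) \<noteq> (\<pi> (q div d') \<noteq> \<pi>' (q mod d'))" for p q
  proof -
    note b = div_mod_less[OF pq(1)] div_mod_less[OF pq(2)]
    show ?thesis
      using graded_matsD(2)[OF assms(1) b(1,3)] graded_matsD(2)[OF assms(2) b(2,4)] par pq
      by (cases "\<pi> (p div d')"; cases "\<pi> (q div d')"; cases "\<pi>' (p mod d')"; cases "\<pi>' (q mod d')") simp_all
  qed
  then show ?thesis unfolding graded_mats_def using kron_carrier by blast
qed

lemma tensor_action_add:
  assumes "A \<in> carrier_mat d d" "A' \<in> carrier_mat d d" "B \<in> carrier_mat d' d'" "B' \<in> carrier_mat d' d'"
  shows "tensor_action d \<pi> d' \<pi>' (A + A') (B + B') =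
    tensor_action d \<pi> d' \<pi>' A B + tensor_action d \<pi> d' \<pi>' A' B'"
  using assms
  by (intro eq_matI) (auto simp: tensor_action_def div_mod_less algebra_simps)

lemma tensor_action_smult:
  assumes "A \<in> carrier_mat d d" "B \<in> carrier_mat d' d'"
  shows "tensor_action d \<pi> d' \<pi>' (c \<cdot>\<^sub>m A) (c \<cdot>\<^sub>m B) = c \<cdot>\<^sub>m tensor_action d \<pi> d' \<pi>' A B"
  using assms
  by (intro eq_matI) (auto simp: tensor_action_def div_mod_less algebra_simps)

lemma supergroup_moduleD:
  assumes "supergroup_module G d \<pi> \<rho> \<sigma>"
  shows "g \<in> pts G \<Longrightarrow> \<rho> g \<in> graded_mats d \<pi> False"
    "\<rho> (1\<^sub>m (mat_size G)) = 1\<^sub>m d"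
    "g \<in> pts G \<Longrightarrow> h \<in> pts G \<Longrightarrow> \<rho> (g * h) = \<rho> g * \<rho> h"
    "x \<in> lie G a \<Longrightarrow> \<sigma> x \<in> graded_mats d \<pi> a"
    "x \<in> lie G a \<Longrightarrow> y \<in> lie G a \<Longrightarrow> \<sigma> (x + y) = \<sigma> x + \<sigma> y"
    "x \<in> lie G a \<Longrightarrow> \<sigma> (c \<cdot>\<^sub>m x) = c \<cdot>\<^sub>m \<sigma> x"
    "x \<in> lie G a \<Longrightarrow> y \<in> lie G b \<Longrightarrow> \<sigma> (mbr a b x y) = mbr a b (\<sigma> x) (\<sigma> y)"
    "g \<in> pts G \<Longrightarrow> h \<in> pts G \<Longrightarrow> g * h = 1\<^sub>m (mat_size G) \<Longrightarrow> x \<in> lie G a \<Longrightarrow>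
       \<sigma> (g * x * h) = \<rho> g * \<sigma> x * \<rho> h"
    "i < d \<Longrightarrow> j < d \<Longrightarrow> \<exists>f D. regular_differential (mat_size G) f D \<and>
       (\<forall>g\<in>pts G. \<rho> g $$ (i,j) = f g) \<and> (\<forall>x\<in>lie G False. \<sigma> x $$ (i,j) = D x)"
  using assms unfolding supergroup_module_def by meson+

text \<open>
  The matrix entries of the group action are products of regular functions, and their differential
  at the identity matches the action of the even Lie algebra by the Leibniz rule. This is where the
  identity has to be a point of the group: it makes the values at the identity of the entry functions
  those of the identity matrix.
\<close>

theorem supergroup_module_tensor:
  assumes one: "1\<^sub>m (mat_size G) \<in> pts G"
    and M: "supergroup_module G d \<pi> \<rho> \<sigma>" and M': "supergroup_module G d' \<pi>' \<rho>' \<sigma>'"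
  shows "supergroup_module G (d * d') (\<lambda>p. \<pi> (p div d') \<noteq> \<pi>' (p mod d'))
    (\<lambda>g. kron d d' (\<rho> g) (\<rho>' g)) (\<lambda>x. tensor_action d \<pi> d' \<pi>' (\<sigma> x) (\<sigma>' x))"
  unfolding supergroup_module_def
proof (intro conjI ballI allI impI)
  note m = supergroup_moduleD[OF M] and m' = supergroup_moduleD[OF M']
  note gr = graded_matsD(1)[OF m(1)] graded_matsD(1)[OF m'(1)]
  note lr = graded_matsD(1)[OF m(4)] graded_matsD(1)[OF m'(4)]
  let ?T = "tensor_action d \<pi> d' \<pi>'"
  show "kron d d' (\<rho> g) (\<rho>' g) \<in> graded_mats (d * d') (\<lambda>p. \<pi> (p div d') \<noteq> \<pi>' (p mod d')) False"
    if "g \<in> pts G" for g by (intro kron_graded m(1) m'(1) that)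
  show "kron d d' (\<rho> (1\<^sub>m (mat_size G))) (\<rho>' (1\<^sub>m (mat_size G))) = 1\<^sub>m (d * d')"
    by (simp add: m(2) m'(2) kron_one)
  show "kron d d' (\<rho> (g * h)) (\<rho>' (g * h)) = kron d d' (\<rho> g) (\<rho>' g) * kron d d' (\<rho> h) (\<rho>' h)"
    if "g \<in> pts G" "h \<in> pts G" for g h
    unfolding m(3)[OF that] m'(3)[OF that] by (intro kron_mult[symmetric] gr that)
  show "?T (\<sigma> x) (\<sigma>' x) \<in> graded_mats (d * d') (\<lambda>p. \<pi> (p div d') \<noteq> \<pi>' (p mod d')) a"
    if "x \<in> lie G a" for a x by (intro tensor_action_graded m(4) m'(4) that)
  show "?T (\<sigma> (x + y)) (\<sigma>' (x + y)) = ?T (\<sigma> x) (\<sigma>' x) + ?T (\<sigma> y) (\<sigma>' y)"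
    if "x \<in> lie G a" "y \<in> lie G a" for a x y
    unfolding m(5)[OF that] m'(5)[OF that]
    by (rule tensor_action_add[OF lr(1)[OF that(1)] lr(1)[OF that(2)] lr(2)[OF that(1)] lr(2)[OF that(2)]])
  show "?T (\<sigma> (c \<cdot>\<^sub>m x)) (\<sigma>' (c \<cdot>\<^sub>m x)) = c \<cdot>\<^sub>m ?T (\<sigma> x) (\<sigma>' x)"
    if "x \<in> lie G a" for a x c
    unfolding m(6)[OF that] m'(6)[OF that]
    by (rule tensor_action_smult[OF lr(1)[OF that] lr(2)[OF that]])
  show "?T (\<sigma> (mbr a b x y)) (\<sigma>' (mbr a b x y)) = mbr a b (?T (\<sigma> x) (\<sigma>' x)) (?T (\<sigma> y) (\<sigma>' y))"
    if "x \<in> lie G a" "y \<in> lie G b" for a b x y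
    unfolding m(7)[OF that] m'(7)[OF that]
    by (rule tensor_action_mbr[OF m(4)[OF that(1)] m(4)[OF that(2)] m'(4)[OF that(1)] m'(4)[OF that(2)]])
  show "?T (\<sigma> (g * x * h)) (\<sigma>' (g * x * h)) =
      kron d d' (\<rho> g) (\<rho>' g) * ?T (\<sigma> x) (\<sigma>' x) * kron d d' (\<rho> h) (\<rho>' h)"
    if gh: "g \<in> pts G" "h \<in> pts G" "g * h = 1\<^sub>m (mat_size G)" and x: "x \<in> lie G a" for g h a x
  proof -
    have "\<rho> g * \<rho> h = 1\<^sub>m d" "\<rho>' g * \<rho>' h = 1\<^sub>m d'"
      using m(3)[OF gh(1,2)] m'(3)[OF gh(1,2)] by (simp_all add: gh(3) m(2) m'(2))
    then show ?thesis
      unfolding m(8)[OF gh x] m'(8)[OF gh x]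
      using tensor_action_conj[OF lr(1)[OF x] m'(4)[OF x] m(1)[OF gh(1)] gr(1)[OF gh(2)] _
          m'(1)[OF gh(1)] m'(1)[OF gh(2)]] by blast
  qed
  show "\<exists>f D. regular_differential (mat_size G) f D \<and>
      (\<forall>g\<in>pts G. kron d d' (\<rho> g) (\<rho>' g) $$ (p, q) = f g) \<and>
      (\<forall>x\<in>lie G False. ?T (\<sigma> x) (\<sigma>' x) $$ (p, q) = D x)"
    if pq: "p < d * d'" "q < d * d'" for p q
  proof -
    note b = div_mod_less[OF pq(1)] div_mod_less[OF pq(2)]
    obtain f D where f: "regular_differential (mat_size G) f D"
      "\<forall>g\<in>pts G. \<rho> g $$ (p div d', q div d') = f g"
      "\<forall>x\<in>lie G False. \<sigma> x $$ (p div d', q div d') = D x"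
      using m(9)[OF b(1,3)] by blast
    obtain f' D' where f': "regular_differential (mat_size G) f' D'"
      "\<forall>g\<in>pts G. \<rho>' g $$ (p mod d', q mod d') = f' g"
      "\<forall>x\<in>lie G False. \<sigma>' x $$ (p mod d', q mod d') = D' x"
      using m'(9)[OF b(2,4)] by blast
    have at_one: "f (1\<^sub>m (mat_size G)) = (if p div d' = q div d' then 1 else 0)"
      "f' (1\<^sub>m (mat_size G)) = (if p mod d' = q mod d' then 1 else 0)"
      using f(2) f'(2) one b m(2) m'(2) by (metis index_one_mat(1))+
    have "?T (\<sigma> x) (\<sigma>' x) $$ (p, q) =
        D x * f' (1\<^sub>m (mat_size G)) + f (1\<^sub>m (mat_size G)) * D' x" if x: "x \<in> lie G False" for x
    proof -
      \<comment> \<open>an even element has no entries between different parities, so the Koszul sign is 1 where it counts\<close>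
      have "D' x = 0" if "\<pi>' (p mod d') \<noteq> \<pi>' (q mod d')"
        using graded_matsD(2)[OF m'(4)[OF x] b(2,4)] that f'(3) x by simp
      then show ?thesis
        using pq f(3) f'(3) x unfolding at_one by (auto simp: tensor_action_def ssign_def)
    qed
    moreover have "kron d d' (\<rho> g) (\<rho>' g) $$ (p, q) = f g * f' g" if "g \<in> pts G" for g
      using that f(2) f'(2) pq by simp
    ultimately show ?thesis using regular_differential.mult[OF f(1) f'(1)] by blast
  qed
qed

lemma supercharactersI:
  "supergroup_module G d \<pi> \<rho> \<sigma> \<Longrightarrow>
     (\<lambda>t. \<Sum>i<d. (if \<pi> i then - 1 else 1) * \<rho> t $$ (i,i)) \<in> supercharacters G"
  unfolding supercharacters_def
  by (intro CollectI exI[of _ d] exI[of _ \<pi>] exI[of _ \<rho>] exI[of _ \<sigma>] conjI refl)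

lemma supercharactersE:
  assumes "\<chi> \<in> supercharacters G"
  obtains d \<pi> \<rho> \<sigma> where "supergroup_module G d \<pi> \<rho> \<sigma>"
    "\<chi> = (\<lambda>t. \<Sum>i<d. (if \<pi> i then - 1 else 1) * \<rho> t $$ (i,i))"
  using assms unfolding supercharacters_def by (elim CollectE exE conjE)

lemma charactersI:
  "supergroup_module G d \<pi> \<rho> \<sigma> \<Longrightarrow> (\<lambda>t. \<Sum>i<d. \<rho> t $$ (i,i)) \<in> characters G"
  unfolding characters_def
  by (intro CollectI exI[of _ d] exI[of _ \<pi>] exI[of _ \<rho>] exI[of _ \<sigma>] conjI refl)

lemma charactersE:
  assumes "\<chi> \<in> characters G"
  obtains d \<pi> \<rho> \<sigma> where "supergroup_module G d \<pi> \<rho> \<sigma>" "\<chi> = (\<lambda>t. \<Sum>i<d. \<rho> t $$ (i,i))"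
  using assms unfolding characters_def by (elim CollectE exE conjE)

lemma fun_spanI: "\<forall>j<(r::nat). F j \<in> S \<Longrightarrow> (\<lambda>x. \<Sum>j<r. c j * F j x) \<in> fun_span S"
  unfolding fun_span_def by (intro CollectI exI[of _ r] exI[of _ c] exI[of _ F] conjI refl)

lemma fun_spanE:
  assumes "f \<in> fun_span S"
  obtains r c F where "f = (\<lambda>x. \<Sum>j<r. c j * F j x)" "\<forall>j<(r::nat). F j \<in> S"
  using assms unfolding fun_span_def by (elim CollectE exE conjE)

text \<open>
  Parities add in a tensor product, so the supertrace of the Kronecker product is the product of
  the supertraces.
\<close>

lemma supercharacters_mult:
  assumes one: "1\<^sub>m (mat_size G) \<in> pts G"
    and "\<chi> \<in> supercharacters G" "\<psi> \<in> supercharacters G"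
  shows "(\<lambda>t. \<chi> t * \<psi> t) \<in> supercharacters G"
proof -
  obtain d \<pi> \<rho> \<sigma> where M: "supergroup_module G d \<pi> \<rho> \<sigma>"
    and chi: "\<chi> = (\<lambda>t. \<Sum>i<d. (if \<pi> i then - 1 else 1) * \<rho> t $$ (i,i))"
    using assms(2) by (rule supercharactersE)
  obtain d' \<pi>' \<rho>' \<sigma>' where M': "supergroup_module G d' \<pi>' \<rho>' \<sigma>'"
    and psi: "\<psi> = (\<lambda>t. \<Sum>i<d'. (if \<pi>' i then - 1 else 1) * \<rho>' t $$ (i,i))"
    using assms(3) by (rule supercharactersE)
  have "\<chi> t * \<psi> t = (\<Sum>p<d * d'. (if \<pi> (p div d') \<noteq> \<pi>' (p mod d') then - 1 else 1) *
      kron d d' (\<rho> t) (\<rho>' t) $$ (p, p))" for t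
  proof -
    have "\<chi> t * \<psi> t = (\<Sum>p<d * d'. ((if \<pi> (p div d') then - 1 else 1) * \<rho> t $$ (p div d', p div d')) *
        ((if \<pi>' (p mod d') then - 1 else 1) * \<rho>' t $$ (p mod d', p mod d')))"
      unfolding chi psi sum_product by (rule sum_div_mod[symmetric])
    also have "\<dots> = (\<Sum>p<d * d'. (if \<pi> (p div d') \<noteq> \<pi>' (p mod d') then - 1 else 1) *
        kron d d' (\<rho> t) (\<rho>' t) $$ (p, p))"
      by (intro sum.cong refl) auto
    finally show ?thesis .
  qed
  then show ?thesis using supercharactersI[OF supergroup_module_tensor[OF one M M']] by simp
qed

lemma characters_mult:
  assumes one: "1\<^sub>m (mat_size G) \<in> pts G"
    and "\<chi> \<in> characters G" "\<psi> \<in> characters G"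
  shows "(\<lambda>t. \<chi> t * \<psi> t) \<in> characters G"
proof -
  obtain d \<pi> \<rho> \<sigma> where M: "supergroup_module G d \<pi> \<rho> \<sigma>"
    and chi: "\<chi> = (\<lambda>t. \<Sum>i<d. \<rho> t $$ (i,i))"
    using assms(2) by (rule charactersE)
  obtain d' \<pi>' \<rho>' \<sigma>' where M': "supergroup_module G d' \<pi>' \<rho>' \<sigma>'"
    and psi: "\<psi> = (\<lambda>t. \<Sum>i<d'. \<rho>' t $$ (i,i))"
    using assms(3) by (rule charactersE)
  have "\<chi> t * \<psi> t = (\<Sum>p<d * d'. kron d d' (\<rho> t) (\<rho>' t) $$ (p, p))" for t
  proof -
    have "\<chi> t * \<psi> t = (\<Sum>p<d * d'. \<rho> t $$ (p div d', p div d') * \<rho>' t $$ (p mod d', p mod d'))"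
      unfolding chi psi sum_product by (rule sum_div_mod[symmetric])
    then show ?thesis by simp
  qed
  then show ?thesis using charactersI[OF supergroup_module_tensor[OF one M M']] by simp
qed

lemma fun_span_mult:
  assumes mult: "\<And>F E. F \<in> S \<Longrightarrow> E \<in> S \<Longrightarrow> (\<lambda>x. F x * E x) \<in> S"
    and "f \<in> fun_span S" "g \<in> fun_span S"
  shows "(\<lambda>x. f x * g x) \<in> fun_span S"
proof -
  obtain r :: nat and c F where f: "f = (\<lambda>x. \<Sum>j<r. c j * F j x)" "\<forall>j<r. F j \<in> S"
    using assms(2) by (rule fun_spanE)
  obtain s :: nat and e E where g: "g = (\<lambda>x. \<Sum>j<s. e j * E j x)" "\<forall>j<s. E j \<in> S"
    using assms(3) by (rule fun_spanE)
  define H where "H p = (\<lambda>x. F (p div s) x * E (p mod s) x)" for p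
  have "f x * g x = (\<Sum>p<r * s. (c (p div s) * e (p mod s)) * H p x)" for x
  proof -
    have "f x * g x = (\<Sum>p<r * s. (c (p div s) * F (p div s) x) * (e (p mod s) * E (p mod s) x))"
      unfolding f g sum_product by (rule sum_div_mod[symmetric])
    then show ?thesis by (simp add: H_def mult_ac)
  qed
  moreover have "\<forall>p<r * s. H p \<in> S"
    unfolding H_def using f(2) g(2) div_mod_less[of _ r s] by (intro allI impI mult) auto
  ultimately show ?thesis
    using fun_spanI[of "r * s" H S "\<lambda>p. c (p div s) * e (p mod s)"] by simp
qed

lemma fun_algebra_sum:
  assumes "finite A" "\<And>a. a \<in> A \<Longrightarrow> f a \<in> fun_algebra S"
  shows "(\<lambda>x. \<Sum>a\<in>A. f a x) \<in> fun_algebra S"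
  using assms
proof induction
  case empty
  show ?case unfolding sum.empty by (rule fun_algebra.const)
next
  case (insert a A)
  have "(\<lambda>x. f a x + (\<Sum>a\<in>A. f a x)) \<in> fun_algebra S"
    by (intro fun_algebra.add insert) auto
  then show ?case using insert.hyps by simp
qed

lemma fun_span_in_fun_algebra:
  assumes gen: "\<And>F. F \<in> A \<Longrightarrow> \<exists>g\<in>fun_algebra S. \<forall>x\<in>X. F x = g x" and "f \<in> fun_span A"
  shows "\<exists>g\<in>fun_algebra S. \<forall>x\<in>X. f x = g x"
proof -
  obtain r :: nat and c F where f: "f = (\<lambda>x. \<Sum>j<r. c j * F j x)" "\<forall>j<r. F j \<in> A"
    using assms(2) by (rule fun_spanE)
  have "\<forall>j\<in>{..<r}. \<exists>g. g \<in> fun_algebra S \<and> (\<forall>x\<in>X. F j x = g x)" using gen f(2) by blast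
  then have "\<exists>g. \<forall>j\<in>{..<r}. g j \<in> fun_algebra S \<and> (\<forall>x\<in>X. F j x = g j x)" by (rule bchoice)
  then obtain g where g: "\<forall>j\<in>{..<r}. g j \<in> fun_algebra S \<and> (\<forall>x\<in>X. F j x = g j x)" ..
  have "(\<lambda>x. \<Sum>j<r. c j * g j x) \<in> fun_algebra S"
    using g by (intro fun_algebra_sum fun_algebra.mult fun_algebra.const) auto
  moreover have "\<forall>x\<in>X. f x = (\<Sum>j<r. c j * g j x)" using g f(1) by simp
  ultimately show ?thesis by (intro bexI[of _ "\<lambda>x. \<Sum>j<r. c j * g j x"])
qed

lemma regular_in_fun_algebra: "regular_differential N f D \<Longrightarrow> f \<in> fun_algebra (GL_coords N)"
proof (induction rule: regular_differential.induct)
  case (coord i j)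
  then show ?case by (intro fun_algebra.gen) (auto simp: GL_coords_def)
next
  case inv_det
  show ?case by (intro fun_algebra.gen) (simp add: GL_coords_def)
next
  case const
  show ?case by (rule fun_algebra.const)
next
  case add
  then show ?case by (intro fun_algebra.add)
next
  case mult
  then show ?case by (intro fun_algebra.mult)
qed

lemma finite_GL_coords: "finite (GL_coords N)"
proof -
  have image: "{(\<lambda>g. g $$ (i,j)) | i j. i < N \<and> j < N} = (\<lambda>(i, j) g. g $$ (i,j)) ` ({..<N} \<times> {..<N})"
    by auto
  show ?thesis unfolding GL_coords_def image by simp
qed

lemma characters_regular:
  assumes "\<chi> \<in> supercharacters G \<or> \<chi> \<in> characters G"
  shows "\<exists>g\<in>fun_algebra (GL_coords (mat_size G)). \<forall>x\<in>pts G. \<chi> x = g x"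
proof -
  obtain d \<pi> \<rho> \<sigma> c where M: "supergroup_module G d \<pi> \<rho> \<sigma>"
    and chi: "\<chi> = (\<lambda>t. \<Sum>i<d. c i * \<rho> t $$ (i,i))"
  proof (cases "\<chi> \<in> supercharacters G")
    case True
    then show ?thesis by (rule supercharactersE) (rule that)
  next
    case False
    then have "\<chi> \<in> characters G" using assms by simp
    then show ?thesis
    proof (rule charactersE)
      fix d \<pi> \<rho> \<sigma>
      assume "supergroup_module G d \<pi> \<rho> \<sigma>" "\<chi> = (\<lambda>t. \<Sum>i<d. \<rho> t $$ (i,i))"
      then show ?thesis using that[of d \<pi> \<rho> \<sigma> "\<lambda>_. 1"] by simp
    qed
  qed
  let ?R = "{F. \<exists>g\<in>fun_algebra (GL_coords (mat_size G)). \<forall>x\<in>pts G. F x = g x}"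
  have "(\<lambda>t. \<rho> t $$ (i,i)) \<in> ?R" if "i < d" for i
    using supergroup_moduleD(9)[OF M that that] regular_in_fun_algebra by blast
  then have "\<chi> \<in> fun_span ?R"
    unfolding chi by (intro fun_spanI) simp
  then show ?thesis by (rule fun_span_in_fun_algebra[rotated]) simp
qed

text \<open>
  The image \<open>E\<close> of the identity of the split torus satisfies \<open>E * E = E\<close>; being invertible, it is the
  identity matrix. The inverse is replaced by the adjugate here.
\<close>

lemma one_in_torus:
  fixes T :: "'k::field mat set"
  assumes "is_torus N T"
  shows "1\<^sub>m N \<in> T"
proof -
  obtain r and \<phi> :: "'k vec \<Rightarrow> 'k mat" where T: "T \<subseteq> {g \<in> carrier_mat N N. det g \<noteq> 0}" and bij: "bij_betw \<phi> (split_torus r) T"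
    and hom: "\<forall>s\<in>split_torus r. \<forall>t\<in>split_torus r. \<phi> (vec r (\<lambda>i. s $ i * t $ i)) = \<phi> s * \<phi> t"
    using assms unfolding is_torus_def by (elim conjE exE) (rule that; assumption)
  define e where "e = (vec r (\<lambda>_. 1) :: 'k vec)"
  define E where "E = \<phi> e"
  have e: "e \<in> split_torus r" by (simp add: e_def split_torus_def)
  have "vec r (\<lambda>i. e $ i * e $ i) = e" by (intro eq_vecI) (simp_all add: e_def)
  then have EE: "E * E = E" using hom e by (metis E_def)
  have ET: "E \<in> T" using bij e unfolding E_def bij_betw_def by blast
  then have E: "E \<in> carrier_mat N N" "det E \<noteq> 0" using T by auto
  have "det E \<cdot>\<^sub>m E = adj_mat E * E * E"
    using E(1) by (simp add: adj_mat(3)[OF E(1)] mult_smult_assoc_mat[OF one_carrier_mat E(1)])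
  also have "\<dots> = adj_mat E * E"
    using adj_mat(1)[OF E(1)] E(1) by (simp add: assoc_mult_mat[of _ N N _ N _ N] EE)
  also have "\<dots> = det E \<cdot>\<^sub>m 1\<^sub>m N" by (rule adj_mat(3)[OF E(1)])
  finally have eq: "det E \<cdot>\<^sub>m E = det E \<cdot>\<^sub>m 1\<^sub>m N" .
  have "E = 1\<^sub>m N"
  proof (rule eq_matI)
    fix i j assume "i < dim_row (1\<^sub>m N :: 'k mat)" "j < dim_col (1\<^sub>m N :: 'k mat)"
    then have ij: "i < N" "j < N" by simp_all
    have "(det E \<cdot>\<^sub>m E) $$ (i,j) = (det E \<cdot>\<^sub>m 1\<^sub>m N) $$ (i,j)" by (simp only: eq)
    then have "det E * E $$ (i,j) = det E * 1\<^sub>m N $$ (i,j)" using ij E(1) by simp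
    then show "E $$ (i,j) = 1\<^sub>m N $$ (i,j)" using E(2) by simp
  qed (use E in auto)
  then show ?thesis using ET by simp
qed

text \<open>
  The coordinate ring of the general linear group is an ambient ring for all tori at once: characters
  are restrictions of polynomials in the matrix entries and the inverse of the determinant.
\<close>

theorem unique_decompositions_torus:
  assumes "maximal_torus G T"
  shows "unique_irreducible_decompositions T (J_super G)"
    and "unique_irreducible_decompositions T (J_char G)"
proof -
  have T: "T \<subseteq> pts G" and one: "1\<^sub>m (mat_size G) \<in> pts G"
    using assms one_in_torus[of "mat_size G" T] by (auto simp: maximal_torus_def)
  have reg: "\<exists>g\<in>fun_algebra (GL_coords (mat_size G)). \<forall>x\<in>T. \<chi> x = g x"
    if "\<chi> \<in> supercharacters G \<or> \<chi> \<in> characters G" for \<chi>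
    using characters_regular[OF that] T by blast
  show "unique_irreducible_decompositions T (J_super G)"
    unfolding J_super_def
  proof (rule unique_decompositions_if_finitely_generated[OF finite_GL_coords])
    show "\<exists>g\<in>fun_algebra (GL_coords (mat_size G)). \<forall>x\<in>T. f x = g x"
      if "f \<in> fun_span (supercharacters G)" for f
      by (rule fun_span_in_fun_algebra[OF reg that]) simp
  qed (intro fun_span_mult supercharacters_mult one)
  show "unique_irreducible_decompositions T (J_char G)"
    unfolding J_char_def
  proof (rule unique_decompositions_if_finitely_generated[OF finite_GL_coords])
    show "\<exists>g\<in>fun_algebra (GL_coords (mat_size G)). \<forall>x\<in>T. f x = g x"
      if "f \<in> fun_span (characters G)" for f
      by (rule fun_span_in_fun_algebra[OF reg that]) simp
  qed (intro fun_span_mult characters_mult one)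
qed

section \<open>Polynomial invariants of Lie superalgebras\<close>

text \<open>
  Evaluation at an element of \<open>H\<close> is, on the dual space, a combination of evaluations at a finite basis,
  so that the symmetric algebra of \<open>H\<close> is finitely generated as far as values on the dual space are
  concerned. The invariance conditions are equations between values of one function and
  hence stable under products.
\<close>

theorem unique_decompositions_KM:
  assumes "lie_superalgebra scale part br" and "cartan_subalgebra scale br (part False) H"
  shows "unique_irreducible_decompositions (dual_space scale H) (I_KM scale part br B H)"
proof -
  interpret lie_superalgebra scale part br by fact
  have H: "subspace H" using assms(2) by (simp add: cartan_subalgebra_def)
  obtain U where U: "finite U" "span U = UNIV" using finite_dim by blast
  obtain C where C: "C \<subseteq> H" "independent C" "H \<subseteq> span C" by (rule basis_exists[of H], rule that)
  have "finite C" using independent_span_bound[OF U(1) C(2)] U(2) by simp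
  define S where "S = (\<lambda>x (l :: 'b \<Rightarrow> 'a). l x) ` C"
  have S: "finite S" using \<open>finite C\<close> by (simp add: S_def)
  let ?reg = "\<lambda>f. \<exists>g\<in>fun_algebra S. \<forall>l\<in>dual_space scale H. f l = g l"
  have eval: "?reg (\<lambda>l. l x)" if "x \<in> H" for x
  proof -
    let ?P = "{x \<in> H. ?reg (\<lambda>l. l x)}"
    have "subspace ?P"
    proof (rule subspaceI)
      have "l 0 = 0" if "l \<in> dual_space scale H" for l
      proof -
        have "l (scale 0 0) = 0 * l 0" using that subspace_0[OF H] unfolding dual_space_def by blast
        then show ?thesis by simp
      qed
      then show "0 \<in> ?P" using subspace_0[OF H] fun_algebra.const[of 0 S] by (intro CollectI conjI bexI[of _ "\<lambda>_. 0"]) auto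
      fix x y assume x: "x \<in> ?P" and y: "y \<in> ?P"
      obtain g where g: "g \<in> fun_algebra S" "\<forall>l\<in>dual_space scale H. l x = g l" using x by blast
      obtain h where h: "h \<in> fun_algebra S" "\<forall>l\<in>dual_space scale H. l y = h l" using y by blast
      have "\<forall>l\<in>dual_space scale H. l (x + y) = g l + h l"
        using g h x y unfolding dual_space_def by simp
      then show "x + y \<in> ?P"
        using subspace_add[OF H] x y fun_algebra.add[OF g(1) h(1)] by (intro CollectI conjI) (blast, rule bexI)
    next
      fix c x assume x: "x \<in> ?P"
      obtain g where g: "g \<in> fun_algebra S" "\<forall>l\<in>dual_space scale H. l x = g l" using x by blast
      have "\<forall>l\<in>dual_space scale H. l (scale c x) = c * g l"
        using g x unfolding dual_space_def by simp
      then show "scale c x \<in> ?P"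
        using subspace_scale[OF H] x fun_algebra.mult[OF fun_algebra.const g(1)] by (intro CollectI conjI) (blast, rule bexI)
    qed
    moreover have "C \<subseteq> ?P"
    proof
      fix x assume "x \<in> C"
      then have "(\<lambda>l. l x) \<in> fun_algebra S" by (intro fun_algebra.gen) (simp add: S_def)
      then show "x \<in> ?P" using C(1) \<open>x \<in> C\<close>
        by (intro CollectI conjI bexI[of _ "\<lambda>l. l x"]) auto
    qed
    ultimately have "span C \<subseteq> ?P" by (rule span_minimal[rotated])
    then show ?thesis using C(3) that by blast
  qed
  have reg: "?reg f" if "f \<in> symmetric_algebra H" for f
    using that unfolding symmetric_algebra_def
  proof induction
    case (gen f)
    then show ?case using eval by blast
  next
    case (const c)
    show ?case by (intro bexI[of _ "\<lambda>_. c"] fun_algebra.const) simp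
  next
    case (add f g)
    then obtain f' g' where "f' \<in> fun_algebra S" "\<forall>l\<in>dual_space scale H. f l = f' l"
      "g' \<in> fun_algebra S" "\<forall>l\<in>dual_space scale H. g l = g' l" by blast
    then show ?case by (intro bexI[of _ "\<lambda>l. f' l + g' l"] fun_algebra.add) simp_all
  next
    case (mult f g)
    then obtain f' g' where "f' \<in> fun_algebra S" "\<forall>l\<in>dual_space scale H. f l = f' l"
      "g' \<in> fun_algebra S" "\<forall>l\<in>dual_space scale H. g l = g' l" by blast
    then show ?case by (intro bexI[of _ "\<lambda>l. f' l * g' l"] fun_algebra.mult) simp_all
  qed
  show ?thesis
  proof (rule unique_decompositions_if_finitely_generated[OF S])
    show "?reg f" if "f \<in> I_KM scale part br B H" for f
      using that by (intro reg) (simp add: I_KM_def)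
    show "(\<lambda>l. f l * g l) \<in> I_KM scale part br B H"
      if f: "f \<in> I_KM scale part br B H" and g: "g \<in> I_KM scale part br B H" for f g
    proof -
      have sym: "h \<in> symmetric_algebra H"
        and weyl: "w \<in> weyl_group scale br (part False) H \<Longrightarrow> l \<in> dual_space scale H \<Longrightarrow> h (w l) = h l"
        and shift: "\<alpha> \<in> isotropic_roots scale br H B \<Longrightarrow> l \<in> dual_space scale H \<Longrightarrow>
          dual_form scale H B l \<alpha> = 0 \<Longrightarrow> h l = h (\<lambda>x. l x + t * \<alpha> x)"
        if "h \<in> I_KM scale part br B H" for h w l \<alpha> t
        using that unfolding I_KM_def by simp_all
      show ?thesis
        unfolding I_KM_def
      proof (intro CollectI conjI ballI allI impI)
        show "(\<lambda>l. f l * g l) \<in> symmetric_algebra H"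
          using sym[OF f] sym[OF g] unfolding symmetric_algebra_def by (rule fun_algebra.mult)
      next
        fix w l assume "w \<in> weyl_group scale br (part False) H" "l \<in> dual_space scale H"
        then show "f (w l) * g (w l) = f l * g l" by (simp only: weyl[OF f] weyl[OF g])
      next
        fix \<alpha> l t
        assume "\<alpha> \<in> isotropic_roots scale br H B" "l \<in> dual_space scale H" "dual_form scale H B l \<alpha> = 0"
        then show "f l * g l = f (\<lambda>x. l x + t * \<alpha> x) * g (\<lambda>x. l x + t * \<alpha> x)"
          by (intro arg_cong2[of _ _ _ _ "(*)"] shift[OF f] shift[OF g])
      qed
    qed
  qed
qed

theorem unique_decompositions_q:
  "unique_irreducible_decompositions (carrier_vec n) (I_q n :: ('k::field vec \<Rightarrow> 'k) set)"
proof (rule unique_decompositions_if_finitely_generated)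
  let ?S = "{(\<lambda>v. v $ i) | i. i < n} :: ('k vec \<Rightarrow> 'k) set"
  show "finite ?S" by simp
  show "\<exists>g\<in>fun_algebra ?S. \<forall>x\<in>carrier_vec n. f x = g x" if "f \<in> I_q n" for f
    using that unfolding I_q_def by (intro bexI[of _ f]) simp_all
  show "(\<lambda>v. f v * g v) \<in> I_q n"
    if f: "f \<in> I_q n" and g: "g \<in> I_q n" for f g :: "'k vec \<Rightarrow> 'k"
  proof -
    let ?line = "\<lambda>v t. vec n (\<lambda>i. if i = n - 1 then t else if i = n - 2 then - t else v $ i)"
    have alg: "h \<in> fun_algebra ?S"
      and perm: "\<pi> permutes {..<n} \<Longrightarrow> v \<in> carrier_vec n \<Longrightarrow> h (vec n (\<lambda>i. v $ \<pi> i)) = h v"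
      and line: "2 \<le> n \<Longrightarrow> v \<in> carrier_vec n \<Longrightarrow> h (?line v s) = h (?line v t)"
      if "h \<in> I_q n" for h :: "'k vec \<Rightarrow> 'k" and \<pi> v s t
      using that unfolding I_q_def by blast+
    show ?thesis
      unfolding I_q_def
    proof (intro CollectI conjI ballI allI impI)
      show "(\<lambda>v. f v * g v) \<in> fun_algebra ?S" using alg[OF f] alg[OF g] by (rule fun_algebra.mult)
    next
      fix \<pi> and v :: "'k vec" assume "\<pi> permutes {..<n}" "v \<in> carrier_vec n"
      then show "f (vec n (\<lambda>i. v $ \<pi> i)) * g (vec n (\<lambda>i. v $ \<pi> i)) = f v * g v"
        by (simp only: perm[OF f] perm[OF g])
    next
      fix v :: "'k vec" and s t assume "2 \<le> n" "v \<in> carrier_vec n"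
      then show "f (?line v s) * g (?line v s) = f (?line v t) * g (?line v t)"
        by (intro arg_cong2[of _ _ _ _ "(*)"] line[OF f] line[OF g])
    qed
  qed
qed

section \<open>Superalgebraic sets of the listed superalgebras and supergroups\<close>

theorem corollary4p8:
  fixes scale :: "'k::{alg_closed_field,field_char_0} \<Rightarrow> 'g::ab_group_add \<Rightarrow> 'g"
    and part :: "bool \<Rightarrow> 'g set" and br :: "'g \<Rightarrow> 'g \<Rightarrow> 'g"
    and B :: "'g \<Rightarrow> 'g \<Rightarrow> 'k" and \<hh> :: "'g set"
  shows
    "(listed_KM_superalgebra scale part br \<and> cartan_subalgebra scale br (part False) \<hh> \<and>
        invariant_form scale part br B \<longrightarrow>
        unique_irreducible_decompositions (dual_space scale \<hh>) (I_KM scale part br B \<hh>)) \<and>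
     (\<forall>n. unique_irreducible_decompositions (carrier_vec n) (I_q n :: ('k vec \<Rightarrow> 'k) set)) \<and>
     (\<forall>(G :: 'k supergroup) T. maximal_torus G T \<longrightarrow>
        ((\<exists>m n. G = GL_super m n) \<or> (\<exists>r n. G = OSP_super r n) \<or>
         (\<exists>m n. m \<noteq> n \<and> G = SL_super m n) \<or> (\<exists>n. G = P_super n) \<longrightarrow>
           unique_irreducible_decompositions T (J_super G)) \<and>
        ((\<exists>n. G = Q_super n) \<longrightarrow> unique_irreducible_decompositions T (J_char G)))"
proof (intro conjI allI impI)
  assume "listed_KM_superalgebra scale part br \<and> cartan_subalgebra scale br (part False) \<hh> \<and>
    invariant_form scale part br B"
  then show "unique_irreducible_decompositions (dual_space scale \<hh>) (I_KM scale part br B \<hh>)"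
    by (intro unique_decompositions_KM) (simp_all add: listed_KM_superalgebra_def)
qed (rule unique_decompositions_q unique_decompositions_torus; assumption?)+

end
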